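(* Let $S$ be a connected, sufficiently differentiable regular surface in the Euclidean space $E^{3}$ without parabolic points, with position vector $\boldsymbol{x}$, and suppose that $S$ is an open part of a ruled surface. Then there exists a constant real $3\times 3$ matrix $\Lambda$ such that $$\Delta^{III}\boldsymbol{x}=\Lambda\boldsymbol{x}\quad\text{on } S$$ if and only if $S$ is an open part of a helicoid.
   Context: Let $S$ be a regular surface in $E^{3}$ with local coordinates $u^{1},u^{2}$, position vector $\boldsymbol{x}=\boldsymbol{x}(u^{1},u^{2})$ and (local) unit normal (Gauss map) $\boldsymbol{n}$. "Without parabolic points" means that the Gauss curvature $K$ of $S$ vanishes nowhere. The third fundamental form of $S$ is $III=\langle d\boldsymbol{n},d\boldsymbol{n}\rangle=e_{ij}\,du^{i}du^{j}$; since $K\neq 0$ it is a Riemannian metric. Let $(e^{ij})$ be the inverse of $(e_{ij})$ and $e=\det(e_{ij})$. The Beltrami operator with respect to $III$ is, for a sufficiently differentiable function $\varphi$ on $S$, $$\Delta^{III}\varphi=-\frac{1}{\sqrt{e}}\,\frac{\partial}{\partial u^{j}}\!\left(\sqrt{e}\,e^{ij}\,\frac{\partial\varphi}{\partial u^{i}}\right)$$ (summation over $i,j\in\{1,2\}$), so that $\Delta=-\partial_x^2-\partial_y^2$ for the metric $dx^2+dy^2$. It acts on the vector-valued function $\boldsymbol{x}$ componentwise (with respect to a fixed Cartesian coordinate system of $E^{3}$). A ruled surface is a surface that can be parametrized as $\boldsymbol{x}(s,t)=\boldsymbol{\alpha}(s)+t\boldsymbol{\beta}(s)$, where $\boldsymbol{\alpha}$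 is a curve (directrix) and $\boldsymbol{\beta}$ is a unit vector field along it (pointing along the rulings). A helicoid is a surface that is, up to a rigid motion of $E^{3}$, of the form $(s,t)\mapsto(t\cos s,\ t\sin s,\ hs)$ with a constant $h\neq 0$. *)

theory Defs
  imports "HOL-Analysis.Analysis" "HOL-Library.Extended_Nat"
begin

section \<open>Functions of class \<open>C\<^sup>k\<close>\<close>

text \<open>All uses are on open sets \<open>U\<close>, hence the unrestricted filter \<open>at x\<close>.\<close>

primrec C_nat_on :: "nat \<Rightarrow> ('a::euclidean_space \<Rightarrow> 'b::real_normed_vector) \<Rightarrow> 'a set \<Rightarrow> bool" where
  "C_nat_on 0 f U \<longleftrightarrow> continuous_on U f"
| "C_nat_on (Suc m) f U \<longleftrightarrow>
     (\<forall>x\<in>U. f differentiable (at x)) \<and>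
     (\<forall>v. C_nat_on m (\<lambda>x. frechet_derivative f (at x) v) U)"

text \<open>Order \<open>k = \<infinity>\<close> is smoothness.\<close>

definition C_on :: "enat \<Rightarrow> ('a::euclidean_space \<Rightarrow> 'b::real_normed_vector) \<Rightarrow> 'a set \<Rightarrow> bool" where
  "C_on k f U \<longleftrightarrow> (\<forall>m. enat m \<le> k \<longrightarrow> C_nat_on m f U)"

definition pderiv_at :: "2 \<Rightarrow> (real^2 \<Rightarrow> 'b::real_normed_vector) \<Rightarrow> real^2 \<Rightarrow> 'b" where
  "pderiv_at i f u = frechet_derivative f (at u) (axis i 1)"


section \<open>Regular surfaces in Euclidean space\<close>

definition immersion_on :: "(real^2) set \<Rightarrow> (real^2 \<Rightarrow> real^3) \<Rightarrow> bool" where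
  "immersion_on U X \<longleftrightarrow> (\<forall>u\<in>U. inj (frechet_derivative X (at u)))"

definition local_parametrization ::
  "enat \<Rightarrow> (real^3) set \<Rightarrow> (real^2) set \<Rightarrow> (real^2 \<Rightarrow> real^3) \<Rightarrow> bool" where
  "local_parametrization k S U X \<longleftrightarrow>
     open U \<and> C_on k X U \<and> immersion_on U X \<and>
     openin (top_of_set S) (X ` U) \<and> (\<exists>Y. homeomorphism U (X ` U) X Y)"

definition regular_surface :: "enat \<Rightarrow> (real^3) set \<Rightarrow> bool" where
  "regular_surface k S \<longleftrightarrow> (\<forall>p\<in>S. \<exists>U X. local_parametrization k S U X \<and> p \<in> X ` U)"


section \<open>Fundamental forms and Gauss curvature in local coordinates\<close>

definition unit_normal :: "(real^2 \<Rightarrow> real^3) \<Rightarrow> real^2 \<Rightarrow> real^3" where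
  "unit_normal X u =
     (let N = cross3 (pderiv_at 1 X u) (pderiv_at 2 X u) in N /\<^sub>R norm N)"

definition first_form :: "(real^2 \<Rightarrow> real^3) \<Rightarrow> real^2 \<Rightarrow> real^2^2" where
  "first_form X u = (\<chi> i j. pderiv_at i X u \<bullet> pderiv_at j X u)"

definition second_form :: "(real^2 \<Rightarrow> real^3) \<Rightarrow> real^2 \<Rightarrow> real^2^2" where
  "second_form X u = (\<chi> i j. pderiv_at j (pderiv_at i X) u \<bullet> unit_normal X u)"

definition third_form :: "(real^2 \<Rightarrow> real^3) \<Rightarrow> real^2 \<Rightarrow> real^2^2" where
  "third_form X u = (\<chi> i j. pderiv_at i (unit_normal X) u \<bullet> pderiv_at j (unit_normal X) u)"

definition gauss_curvature :: "(real^2 \<Rightarrow> real^3) \<Rightarrow> real^2 \<Rightarrow> real" where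
  "gauss_curvature X u = det (second_form X u) / det (first_form X u)"

definition no_parabolic_points :: "enat \<Rightarrow> (real^3) set \<Rightarrow> bool" where
  "no_parabolic_points k S \<longleftrightarrow>
     (\<forall>U X. local_parametrization k S U X \<longrightarrow> (\<forall>u\<in>U. gauss_curvature X u \<noteq> 0))"


section \<open>The Beltrami operator of the third fundamental form\<close>

text \<open>The sign is such that the flat metric yields minus the sum of the second derivatives.\<close>

definition beltrami :: "(real^2 \<Rightarrow> real^2^2) \<Rightarrow> (real^2 \<Rightarrow> real) \<Rightarrow> real^2 \<Rightarrow> real" where
  "beltrami G \<phi> u =
     - (1 / sqrt (det (G u))) *
       (\<Sum>j\<in>UNIV. \<Sum>i\<in>UNIV.
          pderiv_at j (\<lambda>w. sqrt (det (G w)) * matrix_inv (G w) $ i $ j * pderiv_at i \<phi> w) u)"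

definition beltrami_III :: "(real^2 \<Rightarrow> real^3) \<Rightarrow> (real^2 \<Rightarrow> real) \<Rightarrow> real^2 \<Rightarrow> real" where
  "beltrami_III X = beltrami (third_form X)"

definition beltrami_III_position :: "(real^2 \<Rightarrow> real^3) \<Rightarrow> real^2 \<Rightarrow> real^3" where
  "beltrami_III_position X u = (\<chi> c. beltrami_III X (\<lambda>w. X w $ c) u)"


section \<open>Ruled surfaces and helicoids\<close>

definition ruled_map :: "(real \<Rightarrow> real^3) \<Rightarrow> (real \<Rightarrow> real^3) \<Rightarrow> real^2 \<Rightarrow> real^3" where
  "ruled_map \<alpha> \<beta> u = \<alpha> (u $ 1) + (u $ 2) *\<^sub>R \<beta> (u $ 1)"

text \<open>
  Regularity of the ruled parametrization is required only on the part \<open>D\<close> that covers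
  \<open>S\<close>: the complete ruled surface may have singular points or self-intersections. The
  parametrization need not be injective on \<open>D\<close>, so that closed directrices are admitted.
\<close>

definition open_part_of_ruled_surface :: "enat \<Rightarrow> (real^3) set \<Rightarrow> bool" where
  "open_part_of_ruled_surface k S \<longleftrightarrow>
     (\<exists>I \<alpha> \<beta> D. open I \<and> is_interval I \<and> C_on k \<alpha> I \<and> C_on k \<beta> I \<and> (\<forall>s\<in>I. norm (\<beta> s) = 1) \<and>
        open D \<and> D \<subseteq> {u. u $ 1 \<in> I} \<and> immersion_on D (ruled_map \<alpha> \<beta>) \<and>
        S = ruled_map \<alpha> \<beta> ` D)"

definition standard_helicoid :: "real \<Rightarrow> (real^3) set" where
  "standard_helicoid h = {vector [t * cos s, t * sin s, h * s] | s t. True}"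

definition helicoid :: "(real^3) set \<Rightarrow> bool" where
  "helicoid H \<longleftrightarrow>
     (\<exists>h Q b. h \<noteq> 0 \<and> rotation_matrix Q \<and> H = (\<lambda>y. Q *v y + b) ` standard_helicoid h)"

definition open_part_of_helicoid :: "(real^3) set \<Rightarrow> bool" where
  "open_part_of_helicoid S \<longleftrightarrow> (\<exists>H. helicoid H \<and> openin (top_of_set H) S)"

end

theory Submission
  imports Defs "HOL-Complex_Analysis.Conformal_Mappings"
begin

text \<open>
  The normal component of \<open>\<Delta>\<^sup>I\<^sup>I\<^sup>I x\<close> is minus the trace of the second fundamental
  form with respect to the third, i.e. \<open>- 2H/K\<close>. On a ruled surface
  \<open>\<alpha>(s) + t \<beta>(s)\<close> this makes \<open>\<langle>\<Lambda> x, n\<rangle> = - 2H/K\<close> a polynomial identity in \<open>t\<close> for every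
  \<open>s\<close>. Written with the frame \<open>\<beta>, v = \<beta>'/|\<beta>'|, w = \<beta> \<times> v\<close> and the striction curve
  \<open>\<gamma>\<close>, its coefficients say that \<open>w\<close> and the distribution parameter \<open>P\<close> are constant and
  that the component \<open>- c\<close> of \<open>\<gamma>'\<close> along \<open>\<beta>\<close> satisfies differential equations which force
  \<open>c = 0\<close>. Hence \<open>\<gamma>\<close> is a line parallel to \<open>w\<close> and the surface lies locally on a helicoid. By
  analyticity two helicoids that share an open piece coincide, so by connectedness the
  local helicoids are one and the same. Conversely, a helicoid is minimal: its Gauss map is
  conformal and \<open>\<Delta>\<^sup>I\<^sup>I\<^sup>I x = 0\<close>, so \<open>\<Lambda> = 0\<close> works.
\<close>

section \<open>Functions of class \<open>C\<^sup>k\<close> and partial derivatives\<close>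

text \<open>Only three derivatives of the surface are assumed, yet \<open>c = 0\<close> is reached
  by differentiating relations many times. This works because the coefficient relations express the
  derivatives of \<beta>, v, w and \<gamma> through these vectors and P, c, with a common factor
  \<rho> = |\<beta>'|. The entries of \<Lambda> in the frame then satisfy a closed system in the arc
  length of \<beta>, and all further derivatives come for free. For this reason \<open>c\<close> is
  defined through \<Lambda> and not through \<gamma>'. A second obstacle is that S is a point set:
  the hypotheses speak of charts that are homeomorphisms onto open parts of S, while the ruled map
  is only an immersion and may overlap itself. Balls on which it is injective become charts by
  invariance of domain. In the converse the chart is arbitrary, so the standard coordinates of the
  helicoid are treated as functions on it. On a ruled surface, absence of parabolic points means
  that det(\<beta>', \<alpha>', \<beta>) never vanishes; this provides both the frame (\<beta>' is
  nonzero) and a nonzero P.\<close>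

lemma C_nat_on_cong:
  assumes "open U" "\<And>x. x \<in> U \<Longrightarrow> f x = g x" "C_nat_on m f U"
  shows "C_nat_on m g U"
  using assms(2,3)
proof (induction m arbitrary: f g)
  case 0
  then show ?case by (simp cong: continuous_on_cong)
next
  case (Suc m)
  have d: "(g has_derivative frechet_derivative f (at x)) (at x)" if "x \<in> U" for x
    using Suc.prems that assms(1)
    by (auto simp: frechet_derivative_works intro: has_derivative_transform_within_open[of f _ x UNIV U])
  have "frechet_derivative f (at x) = frechet_derivative g (at x)" if "x \<in> U" for x
    using d[OF that] by (rule frechet_derivative_at)
  then have "C_nat_on m (\<lambda>x. frechet_derivative g (at x) v) U" for v
    using Suc.prems Suc.IH[of "\<lambda>x. frechet_derivative f (at x) v"] by auto
  then show ?case
    using differentiableI[OF d] by auto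
qed

text \<open>\<open>C_nat_on\<close> speaks of the derivative chosen by
  \<open>frechet_derivative\<close>. Since derivatives are unique, any explicit formula may replace
  it, and closure under an operation becomes an induction on \<open>m\<close> driven by the matching
  rule of calculus.\<close>

lemma C_nat_on_SucI:
  assumes "open U" "\<And>x. x \<in> U \<Longrightarrow> (f has_derivative f' x) (at x)"
    "\<And>v. C_nat_on m (\<lambda>x. f' x v) U"
  shows "C_nat_on (Suc m) f U"
proof -
  have "f' x = frechet_derivative f (at x)" if "x \<in> U" for x
    using assms(2)[OF that] by (rule frechet_derivative_at)
  then show ?thesis
    using assms C_nat_on_cong[of U "\<lambda>x. f' x v" "\<lambda>x. frechet_derivative f (at x) v" m for v]
    by (auto intro: differentiableI)
qed

lemma C_nat_on_has_derivative:
  "C_nat_on (Suc m) f U \<Longrightarrow> x \<in> U \<Longrightarrow> (f has_derivative frechet_derivative f (at x)) (at x)"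
  by (auto simp: frechet_derivative_works)

lemma C_nat_on_SucD: "C_nat_on (Suc m) f U \<Longrightarrow> C_nat_on m f U"
proof (induction m arbitrary: f)
  case 0
  then show ?case
    by (auto simp: continuous_on_eq_continuous_within
        intro!: continuous_at_imp_continuous_at_within[OF differentiable_imp_continuous_within])
next
  case (Suc m)
  then show ?case by auto
qed

lemma C_nat_on_mono: "m \<le> n \<Longrightarrow> C_nat_on n f U \<Longrightarrow> C_nat_on m f U"
  by (induction n rule: nat_induct) (auto simp: le_Suc_eq simp del: C_nat_on.simps(2) dest: C_nat_on_SucD)

lemma C_nat_on_subset: "C_nat_on m f U \<Longrightarrow> V \<subseteq> U \<Longrightarrow> C_nat_on m f V"
  by (induction m arbitrary: f) (auto intro: continuous_on_subset)

lemma C_nat_on_continuous: "C_nat_on m f U \<Longrightarrow> continuous_on U f"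
  using C_nat_on_mono[of 0 m] by simp

lemma C_nat_on_const: "open U \<Longrightarrow> C_nat_on m (\<lambda>x. c) U"
  by (induction m arbitrary: c) (auto intro: C_nat_on_SucI)

lemma C_nat_on_linear:
  assumes "open U" "bounded_linear f"
  shows "C_nat_on m f U"
proof (cases m)
  case 0
  then show ?thesis using assms by (simp add: linear_continuous_on)
next
  case (Suc n)
  then show ?thesis
    using assms C_nat_on_SucI[of U f "\<lambda>x. f" n] C_nat_on_const[of U]
    by (auto simp: bounded_linear_imp_has_derivative simp del: C_nat_on.simps)
qed

lemma C_nat_on_add:
  assumes "open U" "C_nat_on m f U" "C_nat_on m g U"
  shows "C_nat_on m (\<lambda>x. f x + g x) U"
  using assms(2,3)
proof (induction m arbitrary: f g)
  case 0
  then show ?case by (auto intro: continuous_intros)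
next
  case (Suc m)
  show ?case
    using Suc
    by (intro C_nat_on_SucI[OF assms(1) has_derivative_add[OF C_nat_on_has_derivative[OF Suc.prems(1)]
        C_nat_on_has_derivative[OF Suc.prems(2)]]]) auto
qed

text \<open>One rule serves products, scalings, inner and cross products. The induction ranges over
  both arguments because the product rule pairs each function with a derivative of the
  other.\<close>

lemma C_nat_on_bilinear:
  assumes "bounded_bilinear B" "open U" "C_nat_on m f U" "C_nat_on m g U"
  shows "C_nat_on m (\<lambda>x. B (f x) (g x)) U"
  using assms(3,4)
proof (induction m arbitrary: f g)
  case 0
  then show ?case by (auto intro: bounded_bilinear.continuous_on[OF assms(1)])
next
  case (Suc m)
  show ?case
    using Suc C_nat_on_SucD[OF Suc.prems(1)] C_nat_on_SucD[OF Suc.prems(2)]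
    by (intro C_nat_on_SucI[OF assms(2) bounded_bilinear.FDERIV[OF assms(1)
        C_nat_on_has_derivative[OF Suc.prems(1)] C_nat_on_has_derivative[OF Suc.prems(2)]]]
        C_nat_on_add[OF assms(2)]) auto
qed

lemma C_nat_on_bounded_linear:
  assumes "bounded_linear L" "open U" "C_nat_on m f U"
  shows "C_nat_on m (\<lambda>x. L (f x)) U"
  using assms(3)
proof (induction m arbitrary: f)
  case 0
  then show ?case by (auto intro: bounded_linear.continuous_on[OF assms(1)])
next
  case (Suc m)
  show ?case
    using Suc
    by (intro C_nat_on_SucI[OF assms(2) bounded_linear.has_derivative[OF assms(1)
        C_nat_on_has_derivative[OF Suc.prems(1)]]]) auto
qed

lemmas C_nat_on_mult = C_nat_on_bilinear[OF bounded_bilinear_mult]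
lemmas C_nat_on_scaleR = C_nat_on_bilinear[OF bounded_bilinear_scaleR]
lemmas C_nat_on_inner = C_nat_on_bilinear[OF bounded_bilinear_inner]
lemmas C_nat_on_nth = C_nat_on_bounded_linear[OF bounded_linear_vec_nth]

lemma bounded_bilinear_cross3: "bounded_bilinear cross3"
  using bilinear_cross by (simp add: bilinear_conv_bounded_bilinear)

lemmas C_nat_on_cross3 = C_nat_on_bilinear[OF bounded_bilinear_cross3]

lemma C_nat_on_minus:
  "open U \<Longrightarrow> C_nat_on m f U \<Longrightarrow> C_nat_on m (\<lambda>x. - f x) U"
  by (rule C_nat_on_bounded_linear[OF bounded_linear_minus[OF bounded_linear_ident]])

lemma C_nat_on_diff:
  "open U \<Longrightarrow> C_nat_on m f U \<Longrightarrow> C_nat_on m g U \<Longrightarrow> C_nat_on m (\<lambda>x. f x - g x) U"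
  using C_nat_on_add[of U m f "\<lambda>x. - g x"] C_nat_on_minus[of U m g] by simp

text \<open>The derivative of 1/f is built from f' and 1/f itself; the induction hypothesis supplies
  the latter at the lower order.\<close>

lemma C_nat_on_inverse:
  fixes f :: "'a::euclidean_space \<Rightarrow> real"
  assumes "open U" "\<And>x. x \<in> U \<Longrightarrow> f x \<noteq> 0" "C_nat_on m f U"
  shows "C_nat_on m (\<lambda>x. inverse (f x)) U"
  using assms(3)
proof (induction m)
  case 0
  then show ?case using assms(2) by (auto intro: continuous_intros)
next
  case (Suc m)
  show ?case
    using Suc assms(2) C_nat_on_SucD[OF Suc.prems]
    by (intro C_nat_on_SucI[OF assms(1) Deriv.has_derivative_inverse[OF _
        C_nat_on_has_derivative[OF Suc.prems]]]
        C_nat_on_mult C_nat_on_minus[OF assms(1)] assms(1)) auto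
qed

lemma C_nat_on_sqrt:
  fixes f :: "'a::euclidean_space \<Rightarrow> real"
  assumes "open U" "\<And>x. x \<in> U \<Longrightarrow> f x > 0" "C_nat_on m f U"
  shows "C_nat_on m (\<lambda>x. sqrt (f x)) U"
  using assms(3)
proof (induction m)
  case 0
  then show ?case by (auto intro: continuous_intros)
next
  case (Suc m)
  have *: "((\<lambda>x. sqrt (f x)) has_derivative
      (\<lambda>v. frechet_derivative f (at x) v * (inverse (sqrt (f x)) * (1/2)))) (at x)" if "x \<in> U" for x
    using assms(2)[OF that]
    by (auto intro!: derivative_eq_intros C_nat_on_has_derivative[OF Suc.prems that] simp: field_simps)
  have sq: "C_nat_on m (\<lambda>x. inverse (sqrt (f x))) U"
    using Suc.IH[OF C_nat_on_SucD[OF Suc.prems]] assms(2)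
    by (intro C_nat_on_inverse assms(1)) force+
  show ?case
    using Suc.prems
    by (intro C_nat_on_SucI[OF assms(1) *] C_nat_on_mult assms(1) sq C_nat_on_const) auto
qed

lemma C_on_nat: "C_on k f U \<Longrightarrow> enat m \<le> k \<Longrightarrow> C_nat_on m f U"
  by (simp add: C_on_def)

lemma C_nat_on_pderiv: "C_nat_on (Suc m) f U \<Longrightarrow> C_nat_on m (pderiv_at i f) U"
  by (simp add: pderiv_at_def[abs_def])

lemma has_derivative_pderiv:
  assumes "(f has_derivative f') (at u)"
  shows "pderiv_at i f u = f' (axis i 1)"
  using frechet_derivative_at[OF assms] by (simp add: pderiv_at_def)

lemma vec2_axis: "(v::real^2) = v$1 *\<^sub>R axis 1 1 + v$2 *\<^sub>R axis 2 1"
  by (simp add: vec_eq_iff forall_2 axis_def)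

lemma has_derivative_pderivs:
  assumes "f differentiable (at u)"
  shows "(f has_derivative (\<lambda>v. v$1 *\<^sub>R pderiv_at 1 f u + v$2 *\<^sub>R pderiv_at 2 f u)) (at u)"
proof -
  have d: "(f has_derivative frechet_derivative f (at u)) (at u)"
    using assms by (simp add: frechet_derivative_works)
  have "frechet_derivative f (at u) v = v$1 *\<^sub>R pderiv_at 1 f u + v$2 *\<^sub>R pderiv_at 2 f u" for v
    using has_derivative_linear[OF d] 
    by (subst vec2_axis[of v]) (simp add: linear_add linear_scale pderiv_at_def)
  then show ?thesis using d by (metis (no_types, lifting) ext)
qed

lemma pderiv_at_cong:
  assumes "open U" "u \<in> U" "\<And>x. x \<in> U \<Longrightarrow> f x = g x"
  shows "pderiv_at i f u = pderiv_at i g u"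
proof -
  have "(f has_derivative D) (at u) \<longleftrightarrow> (g has_derivative D) (at u)" for D
    using assms has_derivative_transform_within_open[of f D u UNIV U g]
      has_derivative_transform_within_open[of g D u UNIV U f] by auto
  then show ?thesis by (simp add: pderiv_at_def frechet_derivative_def)
qed

lemma pderiv_at_bilinear:
  assumes "bounded_bilinear B" "f differentiable (at u)" "g differentiable (at u)"
  shows "pderiv_at i (\<lambda>x. B (f x) (g x)) u = B (f u) (pderiv_at i g u) + B (pderiv_at i f u) (g u)"
  using has_derivative_pderiv[OF bounded_bilinear.FDERIV[OF assms(1), of f _ u UNIV g],
      of "frechet_derivative f (at u)" "frechet_derivative g (at u)"] assms(2,3)
  by (simp add: frechet_derivative_works[symmetric] pderiv_at_def)

lemma pderiv_at_linear:
  assumes "bounded_linear L" "f differentiable (at u)"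
  shows "pderiv_at i (\<lambda>x. L (f x)) u = L (pderiv_at i f u)"
  using has_derivative_pderiv[OF bounded_linear.has_derivative[OF assms(1), of f _ "at u"],
      of "frechet_derivative f (at u)"] assms(2)
  by (simp add: frechet_derivative_works[symmetric] pderiv_at_def)

lemma pderiv_at_const: "pderiv_at i (\<lambda>x. c) u = 0"
  by (simp add: pderiv_at_def)

lemma pderiv_at_add:
  assumes "f differentiable (at u)" "g differentiable (at u)"
  shows "pderiv_at i (\<lambda>x. f x + g x) u = pderiv_at i f u + pderiv_at i g u"
  using has_derivative_pderiv[OF has_derivative_add[of f _ "at u" g],
      of "frechet_derivative f (at u)" "frechet_derivative g (at u)"] assms
  by (simp add: frechet_derivative_works[symmetric] pderiv_at_def)

lemma C_nat_on_differentiable: "C_nat_on (Suc m) f U \<Longrightarrow> u \<in> U \<Longrightarrow> f differentiable (at u)"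
  by simp

section \<open>Symmetry of the second partial derivatives\<close>

lemma pderiv_at_line:
  assumes "f differentiable (at (q + x *\<^sub>R axis i 1))"
  shows "((\<lambda>x. f (q + x *\<^sub>R axis i 1)) has_vector_derivative pderiv_at i f (q + x *\<^sub>R axis i 1)) (at x)"
proof -
  have "(f has_derivative frechet_derivative f (at (q + x *\<^sub>R axis i 1))) (at (q + x *\<^sub>R axis i 1))"
    using assms by (simp add: frechet_derivative_works)
  moreover have "((\<lambda>x. q + x *\<^sub>R axis i 1) has_derivative (\<lambda>h. h *\<^sub>R axis i 1)) (at x)"
    by (auto intro!: derivative_eq_intros)
  ultimately have "((\<lambda>x. f (q + x *\<^sub>R axis i 1)) has_derivative
      (\<lambda>h. frechet_derivative f (at (q + x *\<^sub>R axis i 1)) (h *\<^sub>R axis i 1))) (at x)"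
    by (rule has_derivative_compose[rotated])
  moreover have "linear (frechet_derivative f (at (q + x *\<^sub>R axis i 1)))"
    using assms by (simp add: linear_frechet_derivative)
  ultimately show ?thesis
    by (simp add: has_vector_derivative_def pderiv_at_def linear_scale)
qed

text \<open>The mean value theorem is used twice: in direction \<open>i\<close> for the increment
  \<open>G\<close> of \<open>f\<close> across the square, then in direction \<open>j\<close> for
  \<open>pderiv_at i f\<close>.\<close>

lemma double_difference_mvt:
  fixes f :: "real^2 \<Rightarrow> real"
  assumes f: "C_nat_on 2 f U" and h: "h > 0"
    and sq: "\<And>x y. 0 \<le> x \<Longrightarrow> x \<le> h \<Longrightarrow> 0 \<le> y \<Longrightarrow> y \<le> h \<Longrightarrow> u + x *\<^sub>R axis i 1 + y *\<^sub>R axis j 1 \<in> U"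
  obtains x y where "0 < x" "x < h" "0 < y" "y < h"
    "f (u + h *\<^sub>R axis i 1 + h *\<^sub>R axis j 1) - f (u + h *\<^sub>R axis i 1)
      - f (u + h *\<^sub>R axis j 1) + f u
      = h * h * pderiv_at j (pderiv_at i f) (u + x *\<^sub>R axis i 1 + y *\<^sub>R axis j 1)"
proof -
  have f': "C_nat_on (Suc (Suc 0)) f U" using f by (simp add: numeral_2_eq_2)
  have d1: "f differentiable (at p)" if "p \<in> U" for p
    using C_nat_on_differentiable[OF f' that] .
  have d2: "pderiv_at i f differentiable (at p)" if "p \<in> U" for p
    using C_nat_on_differentiable[OF C_nat_on_pderiv[OF f'] that] .
  have sq0: "u + x *\<^sub>R axis i 1 \<in> U" if "0 \<le> x" "x \<le> h" for x
    using sq[OF that, of 0] h by simp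
  define G where "G x = f ((u + h *\<^sub>R axis j 1) + x *\<^sub>R axis i 1) - f (u + x *\<^sub>R axis i 1)" for x
  define G' where "G' = (\<lambda>x. pderiv_at i f ((u + h *\<^sub>R axis j 1) + x *\<^sub>R axis i 1)
      - pderiv_at i f (u + x *\<^sub>R axis i 1))"
  have "(G has_real_derivative G' x) (at x)" if "0 \<le> x" "x \<le> h" for x
  proof -
    have "u + h *\<^sub>R axis j 1 + x *\<^sub>R axis i 1 = u + x *\<^sub>R axis i 1 + h *\<^sub>R axis j 1"
      by (simp only: add.assoc add.commute[of "h *\<^sub>R axis j 1"])
    moreover have "u + x *\<^sub>R axis i 1 + h *\<^sub>R axis j 1 \<in> U"
      using sq[OF that, of h] h by simp
    ultimately have "u + h *\<^sub>R axis j 1 + x *\<^sub>R axis i 1 \<in> U"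
      by (simp only:)
    then show ?thesis
      unfolding G_def[abs_def] G'_def has_real_derivative_iff_has_vector_derivative
      by (intro has_vector_derivative_diff pderiv_at_line d1 sq0 that)
  qed
  then obtain x where x: "0 < x" "x < h" and Gx: "G h - G 0 = (h - 0) * G' x"
    using MVT2[of 0 h G G'] h by metis
  define K where "K = (\<lambda>y. pderiv_at i f ((u + x *\<^sub>R axis i 1) + y *\<^sub>R axis j 1))"
  define K' where "K' = (\<lambda>y. pderiv_at j (pderiv_at i f) ((u + x *\<^sub>R axis i 1) + y *\<^sub>R axis j 1))"
  have "(K has_real_derivative K' y) (at y)" if "0 \<le> y" "y \<le> h" for y
    unfolding has_real_derivative_iff_has_vector_derivative K_def K'_def
    using that x sq[of x y] by (intro pderiv_at_line d2) auto
  then obtain y where y: "0 < y" "y < h" and Gy: "K h - K 0 = (h - 0) * K' y"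
    using MVT2[of 0 h K K'] h by metis
  show ?thesis
    using Gx Gy by (intro that[OF x y]) (simp add: G_def G'_def K_def K'_def algebra_simps)
qed

text \<open>The second difference over a small square is symmetric in \<open>i\<close> and
  \<open>j\<close>, so the two mixed derivatives agree at a pair of points of the square; continuity
  carries this to \<open>u\<close>.\<close>

lemma pderiv_at_commute_real:
  fixes f :: "real^2 \<Rightarrow> real"
  assumes "open U" "u \<in> U" and f: "C_nat_on 2 f U"
  shows "pderiv_at i (pderiv_at j f) u = pderiv_at j (pderiv_at i f) u"
proof -
  define a where "a = pderiv_at i (pderiv_at j f)"
  define b where "b = pderiv_at j (pderiv_at i f)"
  have f': "C_nat_on (Suc (Suc 0)) f U" using f by (simp add: numeral_2_eq_2)
  have "C_nat_on 0 a U" "C_nat_on 0 b U"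
    unfolding a_def b_def by (intro C_nat_on_pderiv f')+
  then have cont: "isCont a u" "isCont b u"
    using assms by (auto simp: continuous_on_eq_continuous_at)
  have "\<bar>a u - b u\<bar> \<le> e" if "e > 0" for e
  proof -
    obtain r1 where r1: "r1 > 0" "\<And>x. dist x u < r1 \<Longrightarrow> dist (a x) (a u) < e/2"
      using cont(1) \<open>e > 0\<close> unfolding continuous_at_eps_delta by (metis half_gt_zero dist_norm)
    obtain r2 where r2: "r2 > 0" "\<And>x. dist x u < r2 \<Longrightarrow> dist (b x) (b u) < e/2"
      using cont(2) \<open>e > 0\<close> unfolding continuous_at_eps_delta by (metis half_gt_zero dist_norm)
    obtain r3 where r3: "r3 > 0" "\<And>x. dist x u < r3 \<Longrightarrow> x \<in> U"
      using assms(1,2) by (auto simp: open_dist)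
    \<comment> \<open>Points of the square are at most \<open>2 * h\<close> away from
      \<open>u\<close>; the divisor 3 leaves room for strict inequalities.\<close>
    define h where "h = min r1 (min r2 r3) / 3"
    have h: "h > 0" "3 * h \<le> r1" "3 * h \<le> r2" "3 * h \<le> r3"
      using r1 r2 r3 by (auto simp: h_def)
    have near: "dist (u + x *\<^sub>R axis k 1 + y *\<^sub>R axis l 1) u < 3 * h"
      if "0 \<le> x" "x \<le> h" "0 \<le> y" "y \<le> h" for x y and k l :: 2
    proof -
      have "norm (x *\<^sub>R axis k (1::real) + y *\<^sub>R axis l 1) \<le> x + y"
        by (rule order_trans[OF norm_triangle_ineq]) (use that in simp)
      then show ?thesis using that h(1) by (simp add: dist_norm add.assoc)
    qed
    have inU: "u + x *\<^sub>R axis k 1 + y *\<^sub>R axis l 1 \<in> U"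
      if "0 \<le> x" "x \<le> h" "0 \<le> y" "y \<le> h" for x y and k l :: 2
      using r3(2) near[OF that, of k l] h by force
    obtain x y where xy: "0 < x" "x < h" "0 < y" "y < h"
      and e1: "f (u + h *\<^sub>R axis i 1 + h *\<^sub>R axis j 1) - f (u + h *\<^sub>R axis i 1)
        - f (u + h *\<^sub>R axis j 1) + f u = h * h * b (u + x *\<^sub>R axis i 1 + y *\<^sub>R axis j 1)"
      using double_difference_mvt[OF f h(1) inU] unfolding b_def by blast
    obtain x' y' where xy': "0 < x'" "x' < h" "0 < y'" "y' < h"
      and e2: "f (u + h *\<^sub>R axis j 1 + h *\<^sub>R axis i 1) - f (u + h *\<^sub>R axis j 1)
        - f (u + h *\<^sub>R axis i 1) + f u = h * h * a (u + x' *\<^sub>R axis j 1 + y' *\<^sub>R axis i 1)"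
      using double_difference_mvt[OF f h(1) inU] unfolding a_def by blast
    have "h * h * a (u + x' *\<^sub>R axis j 1 + y' *\<^sub>R axis i 1) = h * h * b (u + x *\<^sub>R axis i 1 + y *\<^sub>R axis j 1)"
      using e1 e2 by (auto simp: algebra_simps)
    then have "a (u + x' *\<^sub>R axis j 1 + y' *\<^sub>R axis i 1) = b (u + x *\<^sub>R axis i 1 + y *\<^sub>R axis j 1)"
      using h(1) by simp
    moreover have "dist (a (u + x' *\<^sub>R axis j 1 + y' *\<^sub>R axis i 1)) (a u) < e/2"
      using r1(2) near[of x' y' j i] xy' h by force
    moreover have "dist (b (u + x *\<^sub>R axis i 1 + y *\<^sub>R axis j 1)) (b u) < e/2"
      using r2(2) near[of x y i j] xy h by force
    ultimately show ?thesis unfolding dist_real_def by linarith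
  qed
  then have "\<bar>a u - b u\<bar> \<le> 0" using field_le_epsilon[of "\<bar>a u - b u\<bar>" 0] by simp
  then show ?thesis by (simp add: a_def b_def)
qed

lemma pderiv_at_nth:
  fixes f :: "real^2 \<Rightarrow> real^'n"
  assumes "f differentiable (at u)"
  shows "pderiv_at i (\<lambda>x. f x $ c) u = pderiv_at i f u $ c"
  by (rule pderiv_at_linear[OF bounded_linear_vec_nth assms])

lemma pderiv_at_commute:
  fixes f :: "real^2 \<Rightarrow> real^'n"
  assumes "open U" "u \<in> U" and f: "C_nat_on 2 f U"
  shows "pderiv_at i (pderiv_at j f) u = pderiv_at j (pderiv_at i f) u"
proof -
  have f': "C_nat_on (Suc (Suc 0)) f U" using f by (simp add: numeral_2_eq_2)
  have "pderiv_at k (pderiv_at l f) u $ c = pderiv_at k (pderiv_at l (\<lambda>x. f x $ c)) u" for k l c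
  proof -
    have "pderiv_at k (pderiv_at l f) u $ c = pderiv_at k (\<lambda>x. pderiv_at l f x $ c) u"
      using C_nat_on_differentiable[OF C_nat_on_pderiv[OF f'] assms(2)] by (simp add: pderiv_at_nth)
    also have "\<dots> = pderiv_at k (pderiv_at l (\<lambda>x. f x $ c)) u"
      by (rule pderiv_at_cong[OF assms(1,2)])
        (simp add: pderiv_at_nth[OF C_nat_on_differentiable[OF f']])
    finally show ?thesis .
  qed
  then show ?thesis
    using pderiv_at_commute_real[OF assms(1,2) C_nat_on_nth[OF assms(1) f]]
    by (simp add: vec_eq_iff)
qed

section \<open>Immersed patches and the third fundamental form\<close>

lemma cross3_pderiv_nonzero:
  assumes "immersion_on U X" "u \<in> U" "X differentiable (at u)"
  shows "cross3 (pderiv_at 1 X u) (pderiv_at 2 X u) \<noteq> 0"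
proof
  assume *: "cross3 (pderiv_at 1 X u) (pderiv_at 2 X u) = 0"
  let ?F = "frechet_derivative X (at u)"
  have lin: "linear ?F" using assms(3) by (rule linear_frechet_derivative)
  have inj: "?F v = 0 \<Longrightarrow> v = 0" for v
    using assms(1,2) lin linear_injective_0 unfolding immersion_on_def by blast
  have ax: "axis i (1::real) \<noteq> 0" for i :: 2 by (simp add: axis_eq_0_iff)
  from * consider "pderiv_at 1 X u = 0" | "pderiv_at 2 X u = 0"
    | c where "pderiv_at 2 X u = c *\<^sub>R pderiv_at 1 X u"
    unfolding cross_eq_0 collinear_lemma by blast
  then show False
  proof cases
    case 3
    then have "?F (axis 2 1 - c *\<^sub>R axis 1 1) = 0"
      using lin by (simp add: linear_diff linear_scale pderiv_at_def)
    then have "axis 2 1 - c *\<^sub>R axis 1 1 = (0::real^2)" by (rule inj)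
    then show False by (simp add: vec_eq_iff forall_2 axis_def)
  qed (use inj[of "axis 1 1"] inj[of "axis 2 1"] ax in \<open>auto simp: pderiv_at_def\<close>)
qed

lemma tangent_decomposition:
  assumes "cross3 x y \<noteq> 0" "p \<bullet> cross3 x y = 0"
  obtains a b where "p = a *\<^sub>R x + b *\<^sub>R y"
proof -
  let ?N = "cross3 x y"
  \<comment> \<open>Cramer's rule in the basis \<open>x\<close>, \<open>y\<close>,
    \<open>?N\<close>, whose determinant is \<open>?N \<bullet> ?N\<close>.\<close>
  have "(?N \<bullet> ?N) *\<^sub>R p = (p \<bullet> cross3 y ?N) *\<^sub>R x + (p \<bullet> cross3 ?N x) *\<^sub>R y + (p \<bullet> ?N) *\<^sub>R ?N"
    by (simp add: cross3_simps forall_3)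
  then have "(?N \<bullet> ?N) *\<^sub>R p = (p \<bullet> cross3 y ?N) *\<^sub>R x + (p \<bullet> cross3 ?N x) *\<^sub>R y"
    using assms(2) by simp
  then have "p = inverse (?N \<bullet> ?N) *\<^sub>R ((p \<bullet> cross3 y ?N) *\<^sub>R x + (p \<bullet> cross3 ?N x) *\<^sub>R y)"
    using assms(1) by (metis inner_eq_zero_iff inverse_scaleR_times left_inverse scaleR_one scaleR_scaleR)
  then show ?thesis
    by (intro that[of "inverse (?N \<bullet> ?N) * (p \<bullet> cross3 y ?N)" "inverse (?N \<bullet> ?N) * (p \<bullet> cross3 ?N x)"])
      (simp add: scaleR_add_right)
qed

lemma matrix_inv_unique:
  fixes A B :: "real^'n^'n"
  assumes "A ** B = mat 1" "B ** A = mat 1"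
  shows "matrix_inv A = B"
proof -
  have "A ** matrix_inv A = mat 1 \<and> matrix_inv A ** A = mat 1"
    unfolding matrix_inv_def by (rule someI[of _ B]) (simp add: assms)
  then show ?thesis
    by (metis assms(2) matrix_mul_assoc matrix_mul_lid matrix_mul_rid)
qed

lemma matrix_inv_2:
  fixes G :: "real^2^2"
  assumes "det G \<noteq> 0"
  shows "matrix_inv G $ 1 $ 1 = G$2$2 / det G" "matrix_inv G $ 1 $ 2 = - G$1$2 / det G"
    "matrix_inv G $ 2 $ 1 = - G$2$1 / det G" "matrix_inv G $ 2 $ 2 = G$1$1 / det G"
proof -
  define B :: "real^2^2" where
    "B = vector [vector [G$2$2 / det G, - G$1$2 / det G], vector [- G$2$1 / det G, G$1$1 / det G]]"
  have "G$1$1 * G$2$2 - G$1$2 * G$2$1 \<noteq> 0"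
    using assms by (simp add: det_2)
  then have "G ** B = mat 1" "B ** G = mat 1"
    by (simp_all add: B_def matrix_matrix_mult_def mat_def vec_eq_iff forall_2 sum_2 det_2
        divide_simps)
  then have "matrix_inv G = B" by (rule matrix_inv_unique)
  then show "matrix_inv G $ 1 $ 1 = G$2$2 / det G" "matrix_inv G $ 1 $ 2 = - G$1$2 / det G"
    "matrix_inv G $ 2 $ 1 = - G$2$1 / det G" "matrix_inv G $ 2 $ 2 = G$1$1 / det G"
    by (simp_all add: B_def)
qed

text \<open>With \<open>X\<close> of class C^3 the normal is C^2 and the third form C^1, so that the
  outer derivative in the Beltrami operator exists.\<close>

locale immersed_patch =
  fixes U :: "(real^2) set" and X :: "real^2 \<Rightarrow> real^3"
  assumes open_U: "open U" and C3: "C_nat_on 3 X U" and immersion: "immersion_on U X"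
begin

abbreviation "X1 \<equiv> pderiv_at 1 X"
abbreviation "X2 \<equiv> pderiv_at 2 X"
abbreviation "n \<equiv> unit_normal X"
abbreviation "n1 \<equiv> pderiv_at 1 n"
abbreviation "n2 \<equiv> pderiv_at 2 n"

lemma C2_pderiv: "C_nat_on 2 (pderiv_at i X) U"
  using C3 by (intro C_nat_on_pderiv) (simp add: eval_nat_numeral del: C_nat_on.simps)

lemma differentiable_X: "u \<in> U \<Longrightarrow> X differentiable (at u)"
  using C3 C_nat_on_differentiable[of 2 X U u] by (simp add: eval_nat_numeral del: C_nat_on.simps)

lemma differentiable_pderiv: "u \<in> U \<Longrightarrow> pderiv_at i X differentiable (at u)"
  using C2_pderiv C_nat_on_differentiable[of 1 "pderiv_at i X" U u]
  by (simp add: eval_nat_numeral del: C_nat_on.simps)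

lemma normal_nonzero: "u \<in> U \<Longrightarrow> cross3 (X1 u) (X2 u) \<noteq> 0"
  using cross3_pderiv_nonzero[OF immersion _ differentiable_X] .

lemma unit_normal_alt:
  "n u = inverse (sqrt (cross3 (X1 u) (X2 u) \<bullet> cross3 (X1 u) (X2 u))) *\<^sub>R cross3 (X1 u) (X2 u)"
  by (simp add: unit_normal_def Let_def norm_eq_sqrt_inner divide_inverse)

lemma C2_normal: "C_nat_on 2 n U"
proof -
  have c: "C_nat_on 2 (\<lambda>u. cross3 (X1 u) (X2 u)) U"
    by (intro C_nat_on_cross3 open_U C2_pderiv)
  show ?thesis
    unfolding unit_normal_alt[abs_def] 
    by (intro C_nat_on_scaleR open_U C_nat_on_inverse C_nat_on_sqrt C_nat_on_inner c)
      (use normal_nonzero in auto)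
qed

lemma differentiable_normal: "u \<in> U \<Longrightarrow> n differentiable (at u)"
  using C2_normal C_nat_on_differentiable[of 1 n U u]
  by (simp add: eval_nat_numeral del: C_nat_on.simps)

lemma C1_normal_pderiv: "C_nat_on 1 (pderiv_at i n) U"
  using C2_normal by (intro C_nat_on_pderiv) (simp add: eval_nat_numeral del: C_nat_on.simps)

lemma normal_unit: "u \<in> U \<Longrightarrow> n u \<bullet> n u = 1"
  using normal_nonzero[of u]
  by (simp add: unit_normal_def Let_def power2_norm_eq_inner[symmetric] dot_square_norm power2_eq_square)

lemma normal_orthogonal: "n u \<bullet> pderiv_at i X u = 0"
  using exhaust_2[of i] by (auto simp: unit_normal_alt dot_cross_self)

lemma normal_pderiv_orthogonal:
  assumes "u \<in> U"
  shows "n u \<bullet> pderiv_at i n u = 0"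
proof -
  have "pderiv_at i (\<lambda>w. n w \<bullet> n w) u = pderiv_at i (\<lambda>w. 1) u"
    by (rule pderiv_at_cong[OF open_U assms]) (simp add: normal_unit)
  then show ?thesis
    using pderiv_at_bilinear[OF bounded_bilinear_inner, of n u n i] differentiable_normal[OF assms]
    by (simp add: pderiv_at_const inner_commute)
qed

text \<open>Differentiating the orthogonality of \<open>n\<close> and the tangent vectors shifts one
  derivative from \<open>X\<close> onto \<open>n\<close>.\<close>

lemma second_form_eq:
  assumes "u \<in> U"
  shows "second_form X u $ i $ j = - (pderiv_at i X u \<bullet> pderiv_at j n u)"
proof -
  have "pderiv_at j (\<lambda>w. pderiv_at i X w \<bullet> n w) u = pderiv_at j (\<lambda>w. 0) u"
    by (rule pderiv_at_cong[OF open_U assms]) (simp add: normal_orthogonal inner_commute)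
  then show ?thesis
    using pderiv_at_bilinear[OF bounded_bilinear_inner, of "pderiv_at i X" u n j]
      differentiable_normal[OF assms] differentiable_pderiv[OF assms]
    by (simp add: pderiv_at_const second_form_def)
qed

lemma orthogonal_normal_decomposition:
  assumes "u \<in> U" "p \<bullet> n u = 0"
  obtains a b where "p = a *\<^sub>R X1 u + b *\<^sub>R X2 u"
  using tangent_decomposition[OF normal_nonzero[OF assms(1)], of p] assms normal_nonzero[OF assms(1)]
  by (auto simp: unit_normal_alt)

lemma first_form_det_pos: "u \<in> U \<Longrightarrow> det (first_form X u) > 0"
  using normal_nonzero[of u] inner_gt_zero_iff[of "cross3 (X1 u) (X2 u)"]
  by (simp add: first_form_def det_2 dot_cross inner_commute)

lemma third_form_symmetric: "third_form X u $ 2 $ 1 = third_form X u $ 1 $ 2"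
  by (simp add: third_form_def inner_commute)

text \<open>With the Weingarten matrix \<open>A\<close> one has \<open>e = A g A\<^sup>T\<close> and \<open>h = - g A\<^sup>T\<close>, so both sides of
  the trace identity equal \<open>- tr A (det A det g)\<^sup>2\<close>.\<close>

lemma third_form_relations:
  assumes "u \<in> U"
  defines "g \<equiv> first_form X u" and "h \<equiv> second_form X u" and "e \<equiv> third_form X u"
  shows "det e * det g = det h ^ 2"
    "(e$2$2 * h$1$1 - e$1$2 * (h$1$2 + h$2$1) + e$1$1 * h$2$2) * det h
      = (g$2$2 * h$1$1 - g$1$2 * (h$1$2 + h$2$1) + g$1$1 * h$2$2) * det e"
proof -
  have o: "n1 u \<bullet> n u = 0" "n2 u \<bullet> n u = 0"
    using normal_pderiv_orthogonal[OF assms(1)] by (simp_all add: inner_commute)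
  obtain a b where n1: "n1 u = a *\<^sub>R X1 u + b *\<^sub>R X2 u"
    using orthogonal_normal_decomposition[OF assms(1) o(1)] .
  obtain c d where n2: "n2 u = c *\<^sub>R X1 u + d *\<^sub>R X2 u"
    using orthogonal_normal_decomposition[OF assms(1) o(2)] .
  define p q r where "p = X1 u \<bullet> X1 u" and "q = X1 u \<bullet> X2 u" and "r = X2 u \<bullet> X2 u"
  have g: "g$1$1 = p" "g$1$2 = q" "g$2$1 = q" "g$2$2 = r"
    by (simp_all add: g_def first_form_def p_def q_def r_def inner_commute)
  have h: "h$1$1 = - (a * p + b * q)" "h$1$2 = - (c * p + d * q)"
      "h$2$1 = - (a * q + b * r)" "h$2$2 = - (c * q + d * r)"
    unfolding h_def second_form_eq[OF assms(1)] n1 n2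
    by (simp_all add: inner_add_right p_def q_def r_def inner_commute)
  have e: "e$1$1 = a*a*p + 2*a*b*q + b*b*r" "e$1$2 = a*c*p + a*d*q + b*c*q + b*d*r"
      "e$2$1 = a*c*p + a*d*q + b*c*q + b*d*r" "e$2$2 = c*c*p + 2*c*d*q + d*d*r"
    unfolding e_def third_form_def by (simp_all add: n1 n2 inner_add_left inner_add_right p_def q_def r_def
        inner_commute algebra_simps)
  show "det e * det g = det h ^ 2"
    unfolding det_2 g h e by algebra
  show "(e$2$2 * h$1$1 - e$1$2 * (h$1$2 + h$2$1) + e$1$1 * h$2$2) * det h
      = (g$2$2 * h$1$1 - g$1$2 * (h$1$2 + h$2$1) + g$1$1 * h$2$2) * det e"
    unfolding det_2 g h e by algebra
qed

text \<open>The vectors \<open>\<surd>e \<Sum>\<^sub>i e\<^sup>i\<^sup>j x\<^sub>i\<close> for \<open>j = 1, 2\<close>, whose divergence is \<open>- \<surd>e \<Delta> x\<close>.\<close>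

definition V1 :: "real^2 \<Rightarrow> real^3" where
  "V1 w = (let e = third_form X w in
     inverse (sqrt (det e)) *\<^sub>R (e$2$2 *\<^sub>R X1 w - e$1$2 *\<^sub>R X2 w))"

definition V2 :: "real^2 \<Rightarrow> real^3" where
  "V2 w = (let e = third_form X w in
     inverse (sqrt (det e)) *\<^sub>R (e$1$1 *\<^sub>R X2 w - e$1$2 *\<^sub>R X1 w))"

end

section \<open>The Beltrami operator on the position vector and its normal component\<close>

locale nonparabolic_patch = immersed_patch +
  assumes gauss_curvature_nonzero: "u \<in> U \<Longrightarrow> gauss_curvature X u \<noteq> 0"
begin

lemma second_form_det_nonzero: "u \<in> U \<Longrightarrow> det (second_form X u) \<noteq> 0"
  using gauss_curvature_nonzero by (auto simp: gauss_curvature_def)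

text \<open>Nonzero curvature enters here: det e * det g is the square of det h, which is nonzero,
  and det g is positive.\<close>

lemma third_form_det_pos:
  assumes "u \<in> U" shows "det (third_form X u) > 0"
proof -
  have "det (third_form X u) * det (first_form X u) > 0"
    using third_form_relations(1)[OF assms] second_form_det_nonzero[OF assms] by simp
  then show ?thesis using first_form_det_pos[OF assms] by (simp add: zero_less_mult_iff)
qed

lemma C1_third_form: "C_nat_on 1 (\<lambda>w. third_form X w $ i $ j) U"
  unfolding third_form_def vec_lambda_beta by (intro C_nat_on_inner open_U C1_normal_pderiv)

lemma C1_third_form_det: "C_nat_on 1 (\<lambda>w. inverse (sqrt (det (third_form X w)))) U"
  unfolding det_2
  by (intro C_nat_on_inverse C_nat_on_sqrt C_nat_on_diff C_nat_on_mult open_U C1_third_form)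
    (use third_form_det_pos in \<open>force simp: det_2\<close>)+

lemma C1_pderiv: "C_nat_on 1 (pderiv_at i X) U"
  using C2_pderiv by (rule C_nat_on_mono[rotated]) simp

lemma C1_V: "C_nat_on 1 V1 U" "C_nat_on 1 V2 U"
  unfolding V1_def[abs_def] V2_def[abs_def] Let_def
  by (intro C_nat_on_scaleR C_nat_on_diff open_U C1_third_form C1_third_form_det C1_pderiv)+

text \<open>For a 2 by 2 matrix, sqrt(det e) times the inverse is the adjugate divided by sqrt(det
  e). This turns the three scalar fluxes into the components of \<open>V1\<close> and
  \<open>V2\<close>.\<close>

lemma beltrami_III_position_eq:
  assumes "u \<in> U"
  shows "beltrami_III_position X u =
    - inverse (sqrt (det (third_form X u))) *\<^sub>R (pderiv_at 1 V1 u + pderiv_at 2 V2 u)"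
proof -
  let ?e = "third_form X"
  have diff: "f differentiable (at u)" if "C_nat_on 1 f U" for f :: "real^2 \<Rightarrow> 'b::real_normed_vector"
    using C_nat_on_differentiable[of 0 f] that assms by simp
  have sq: "sqrt d * (x / d) = inverse (sqrt d) * x" if "d > 0" for d x :: real
    using that by (simp add: field_simps)
  have W: "sqrt (det (?e w)) * matrix_inv (?e w) $ 1 $ 1 = inverse (sqrt (det (?e w))) * ?e w $ 2 $ 2"
    "sqrt (det (?e w)) * matrix_inv (?e w) $ 1 $ 2 = - (inverse (sqrt (det (?e w))) * ?e w $ 1 $ 2)"
    "sqrt (det (?e w)) * matrix_inv (?e w) $ 2 $ 1 = - (inverse (sqrt (det (?e w))) * ?e w $ 1 $ 2)"
    "sqrt (det (?e w)) * matrix_inv (?e w) $ 2 $ 2 = inverse (sqrt (det (?e w))) * ?e w $ 1 $ 1"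
    if "w \<in> U" for w
  proof -
    have pos: "det (?e w) > 0" by (rule third_form_det_pos[OF that])
    then have "det (?e w) \<noteq> 0" by simp
    note inv = matrix_inv_2[OF this]
    show "sqrt (det (?e w)) * matrix_inv (?e w) $ 1 $ 1 = inverse (sqrt (det (?e w))) * ?e w $ 2 $ 2"
      "sqrt (det (?e w)) * matrix_inv (?e w) $ 1 $ 2 = - (inverse (sqrt (det (?e w))) * ?e w $ 1 $ 2)"
      "sqrt (det (?e w)) * matrix_inv (?e w) $ 2 $ 1 = - (inverse (sqrt (det (?e w))) * ?e w $ 1 $ 2)"
      "sqrt (det (?e w)) * matrix_inv (?e w) $ 2 $ 2 = inverse (sqrt (det (?e w))) * ?e w $ 1 $ 1"
      unfolding inv third_form_symmetric sq[OF pos] by simp_all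
  qed
  have C: "C_nat_on 1 (\<lambda>w. inverse (sqrt (det (?e w))) * ?e w $ i $ j * pderiv_at k X w $ c) U" for i j k c
    by (intro C_nat_on_mult C_nat_on_nth open_U C1_third_form C1_third_form_det C1_pderiv)
  note D = diff[OF C]
  have "beltrami_III X (\<lambda>w. X w $ c) u = (- inverse (sqrt (det (?e u))) *\<^sub>R (pderiv_at 1 V1 u + pderiv_at 2 V2 u)) $ c" for c
  proof -
    define a where "a i j k = (\<lambda>w. inverse (sqrt (det (?e w))) * ?e w $ i $ j * pderiv_at k X w $ c)" for i j k
    have t: "pderiv_at j (\<lambda>w. sqrt (det (?e w)) * matrix_inv (?e w) $ i $ j * pderiv_at i (\<lambda>w. X w $ c) w) u
        = pderiv_at j (\<lambda>w. sqrt (det (?e w)) * matrix_inv (?e w) $ i $ j * pderiv_at i X w $ c) u" for i j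
      by (rule pderiv_at_cong[OF open_U assms]) (simp add: pderiv_at_nth[OF differentiable_X])
    have t11: "pderiv_at 1 (\<lambda>w. sqrt (det (?e w)) * matrix_inv (?e w) $ 1 $ 1 * pderiv_at 1 X w $ c) u
        = pderiv_at 1 (a 2 2 1) u"
      by (rule pderiv_at_cong[OF open_U assms])
        (simp add: a_def W)
    have t12: "pderiv_at 2 (\<lambda>w. sqrt (det (?e w)) * matrix_inv (?e w) $ 1 $ 2 * pderiv_at 1 X w $ c) u
        = pderiv_at 2 (\<lambda>w. - a 1 2 1 w) u"
      by (rule pderiv_at_cong[OF open_U assms])
        (simp add: a_def W)
    have t21: "pderiv_at 1 (\<lambda>w. sqrt (det (?e w)) * matrix_inv (?e w) $ 2 $ 1 * pderiv_at 2 X w $ c) u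
        = pderiv_at 1 (\<lambda>w. - a 1 2 2 w) u"
      by (rule pderiv_at_cong[OF open_U assms])
        (simp add: a_def W)
    have t22: "pderiv_at 2 (\<lambda>w. sqrt (det (?e w)) * matrix_inv (?e w) $ 2 $ 2 * pderiv_at 2 X w $ c) u
        = pderiv_at 2 (a 1 1 2) u"
      by (rule pderiv_at_cong[OF open_U assms])
        (simp add: a_def W)
    have Da: "a i j k differentiable (at u)" for i j k unfolding a_def by (rule D)
    have Dm: "(\<lambda>w. - a i j k w) differentiable (at u)" for i j k
      using Da by (rule differentiable_minus)
    have e1: "(\<lambda>w. V1 w $ c) = (\<lambda>w. a 2 2 1 w + - a 1 2 2 w)"
      and e2: "(\<lambda>w. V2 w $ c) = (\<lambda>w. - a 1 2 1 w + a 1 1 2 w)"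
      by (simp_all add: a_def V1_def V2_def Let_def algebra_simps)
    have v1: "pderiv_at 1 V1 u $ c = pderiv_at 1 (a 2 2 1) u + pderiv_at 1 (\<lambda>w. - a 1 2 2 w) u"
      unfolding pderiv_at_nth[OF diff[OF C1_V(1)], symmetric] e1 by (rule pderiv_at_add[OF Da Dm])
    have v2: "pderiv_at 2 V2 u $ c = pderiv_at 2 (\<lambda>w. - a 1 2 1 w) u + pderiv_at 2 (a 1 1 2) u"
      unfolding pderiv_at_nth[OF diff[OF C1_V(2)], symmetric] e2 by (rule pderiv_at_add[OF Dm Da])
    show ?thesis
      unfolding beltrami_III_def beltrami_def t sum_2 t11 t12 t21 t22
      by (simp add: v1 v2 divide_inverse algebra_simps)
  qed
  then show ?thesis by (simp add: beltrami_III_position_def vec_eq_iff)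
qed

text \<open>\<open>V1\<close> and \<open>V2\<close> are tangent, so the product rule shifts their
  derivatives onto \<open>n\<close> and no derivative of the third form survives.
  \<open>third_form_relations\<close> then trades the third form for the first. The right-hand side
  is -2H det g; dividing by det h gives -2H/K.\<close>

lemma beltrami_III_position_normal:
  assumes "u \<in> U"
  defines "g \<equiv> first_form X u" and "h \<equiv> second_form X u"
  shows "(beltrami_III_position X u \<bullet> n u) * det h
    = - (g$2$2 * h$1$1 - g$1$2 * (h$1$2 + h$2$1) + g$1$1 * h$2$2)"
proof -
  let ?e = "third_form X u"
  have dV: "V1 differentiable (at u)" "V2 differentiable (at u)"
    using C_nat_on_differentiable[of 0 _ U] C1_V assms(1) by (simp_all del: C_nat_on.simps)
  have *: "pderiv_at j V u \<bullet> n u = - (V u \<bullet> pderiv_at j n u)"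
    if "V differentiable (at u)" "\<And>w. V w \<bullet> n w = 0" for V j
    using pderiv_at_bilinear[OF bounded_bilinear_inner that(1) differentiable_normal[OF assms(1)], of j]
    by (simp add: that(2) pderiv_at_const)
  have V: "V1 w \<bullet> n w = 0" "V2 w \<bullet> n w = 0" for w
    using normal_orthogonal[of w] by (simp_all add: V1_def V2_def Let_def inner_diff_left inner_commute[of _ "n w"] inner_diff_right)
  have pos: "det ?e > 0" by (rule third_form_det_pos[OF assms(1)])
  have "beltrami_III_position X u \<bullet> n u = inverse (sqrt (det ?e)) * (V1 u \<bullet> n1 u + V2 u \<bullet> n2 u)"
    by (simp add: beltrami_III_position_eq[OF assms(1)] inner_add_left *[OF dV(1) V(1)] *[OF dV(2) V(2)]
        algebra_simps)
  also have "V1 u \<bullet> n1 u + V2 u \<bullet> n2 u = - inverse (sqrt (det ?e)) *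
      (?e$2$2 * h$1$1 - ?e$1$2 * (h$1$2 + h$2$1) + ?e$1$1 * h$2$2)"
    unfolding h_def second_form_eq[OF assms(1)]
    by (simp add: V1_def V2_def Let_def inner_diff_left algebra_simps)
  also have "inverse (sqrt (det ?e)) * (- inverse (sqrt (det ?e)) *
      (?e$2$2 * h$1$1 - ?e$1$2 * (h$1$2 + h$2$1) + ?e$1$1 * h$2$2))
      = - (?e$2$2 * h$1$1 - ?e$1$2 * (h$1$2 + h$2$1) + ?e$1$1 * h$2$2) / det ?e"
    using pos by (simp add: field_simps)
  finally have n: "beltrami_III_position X u \<bullet> n u
    = - (?e$2$2 * h$1$1 - ?e$1$2 * (h$1$2 + h$2$1) + ?e$1$1 * h$2$2) / det ?e" .
  have "b * k = - G" if "b = - E / d" "E * k = G * d" "d > 0" for b E d k G :: real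
  proof -
    have "b * k = - (E * k) / d" by (simp add: that(1))
    then show ?thesis using that(3) by (simp add: that(2))
  qed
  from this[OF n third_form_relations(2)[OF assms(1), folded g_def h_def] pos] show ?thesis .
qed

end

section \<open>Ruled surfaces with an eigenvalue equation\<close>

lemma has_derivative_ruled_map:
  assumes "(f has_vector_derivative f') (at (u$1))" "(g has_vector_derivative g') (at (u$1))"
  shows "(ruled_map f g has_derivative
    (\<lambda>v. v$1 *\<^sub>R (f' + u$2 *\<^sub>R g') + v$2 *\<^sub>R g (u$1))) (at u)"
proof -
  have c: "((\<lambda>u::real^2. u $ i) has_derivative (\<lambda>v. v $ i)) (at u)" for i
    by (rule bounded_linear_imp_has_derivative[OF bounded_linear_vec_nth])
  have "((\<lambda>u. f (u$1)) has_derivative (\<lambda>v. v$1 *\<^sub>R f')) (at u)"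
    using has_derivative_compose[OF c, of f "\<lambda>x. x *\<^sub>R f'" 1] assms(1)
    by (simp add: has_vector_derivative_def)
  moreover have "((\<lambda>u. g (u$1)) has_derivative (\<lambda>v. v$1 *\<^sub>R g')) (at u)"
    using has_derivative_compose[OF c, of g "\<lambda>x. x *\<^sub>R g'" 1] assms(2)
    by (simp add: has_vector_derivative_def)
  ultimately show ?thesis
    unfolding ruled_map_def[abs_def]
    by (auto intro!: derivative_eq_intros c simp: algebra_simps)
qed

lemma pderiv_ruled_map:
  assumes "(f has_vector_derivative f') (at (u$1))" "(g has_vector_derivative g') (at (u$1))"
  shows "pderiv_at 1 (ruled_map f g) u = f' + u$2 *\<^sub>R g'" "pderiv_at 2 (ruled_map f g) u = g (u$1)"
  using has_derivative_pderiv[OF has_derivative_ruled_map[OF assms]] by (simp_all add: axis_def)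

text \<open>Rulings are asymptotic lines of unit speed, so h22 = 0 and g22 = 1, and the trace
  involves only h11, h12, h21 and g12. Clearing powers of |N| makes both sides polynomials in
  \<open>t\<close>.\<close>

lemma ruled_beltrami_equation:
  fixes \<alpha> \<beta> :: "real \<Rightarrow> real^3" and \<Lambda> :: "real^3^3"
  assumes patch: "nonparabolic_patch U (ruled_map \<alpha> \<beta>)"
    and I: "open I" "U \<subseteq> {u. u $ 1 \<in> I}" and unit: "\<And>s. s \<in> I \<Longrightarrow> norm (\<beta> s) = 1"
    and der: "\<And>s. s \<in> I \<Longrightarrow> (\<alpha> has_vector_derivative \<alpha>1 s) (at s)"
      "\<And>s. s \<in> I \<Longrightarrow> (\<beta> has_vector_derivative \<beta>1 s) (at s)"
      "\<And>s. s \<in> I \<Longrightarrow> (\<alpha>1 has_vector_derivative \<alpha>2 s) (at s)"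
      "\<And>s. s \<in> I \<Longrightarrow> (\<beta>1 has_vector_derivative \<beta>2 s) (at s)"
    and eq: "\<And>u. u \<in> U \<Longrightarrow> beltrami_III_position (ruled_map \<alpha> \<beta>) u = \<Lambda> *v ruled_map \<alpha> \<beta> u"
    and u: "u \<in> U" "s = u $ 1" "t = u $ 2"
  defines "N \<equiv> cross3 (\<alpha>1 s + t *\<^sub>R \<beta>1 s) (\<beta> s)" and "\<delta> \<equiv> \<beta>1 s \<bullet> cross3 (\<alpha>1 s) (\<beta> s)"
  shows "\<delta> \<noteq> 0" "((\<Lambda> *v (\<alpha> s + t *\<^sub>R \<beta> s)) \<bullet> N) * \<delta>\<^sup>2
    = (N \<bullet> N) * ((\<alpha>2 s + t *\<^sub>R \<beta>2 s) \<bullet> N - 2 * \<delta> * (\<alpha>1 s \<bullet> \<beta> s))"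
proof -
  interpret nonparabolic_patch U "ruled_map \<alpha> \<beta>" by fact
  have s: "s \<in> I" using I u by auto
  have inI: "w $ 1 \<in> I" if "w \<in> U" for w using that I by auto
  \<comment> \<open>The partial derivatives of a ruled map are ruled maps again, so
    \<open>pderiv_ruled_map\<close> also yields the second derivatives.\<close>
  have X1: "X1 w = ruled_map \<alpha>1 \<beta>1 w" if "w \<in> U" for w
    using pderiv_ruled_map(1)[OF der(1,2)[OF inI[OF that]]] by (simp add: ruled_map_def)
  have X2: "X2 w = ruled_map \<beta> (\<lambda>s. 0) w" if "w \<in> U" for w
    using pderiv_ruled_map(2)[OF der(1,2)[OF inI[OF that]]] by (simp add: ruled_map_def)
  have X1j: "pderiv_at j X1 u = pderiv_at j (ruled_map \<alpha>1 \<beta>1) u" for j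
    by (rule pderiv_at_cong[OF open_U u(1) X1])
  have X2j: "pderiv_at j X2 u = pderiv_at j (ruled_map \<beta> (\<lambda>s. 0)) u" for j
    by (rule pderiv_at_cong[OF open_U u(1) X2])
  have X11: "pderiv_at 1 X1 u = \<alpha>2 s + t *\<^sub>R \<beta>2 s" and X12: "pderiv_at 2 X1 u = \<beta>1 s"
    using pderiv_ruled_map[OF der(3,4)] s u by (simp_all add: X1j)
  have X21: "pderiv_at 1 X2 u = \<beta>1 s" and X22: "pderiv_at 2 X2 u = 0"
    using pderiv_ruled_map[OF der(2) has_vector_derivative_const] s u by (simp_all add: X2j)
  have "((\<lambda>s. \<beta> s \<bullet> \<beta> s) has_derivative (\<lambda>h. \<beta> s \<bullet> (h *\<^sub>R \<beta>1 s) + (h *\<^sub>R \<beta>1 s) \<bullet> \<beta> s)) (at s)"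
    using der(2)[OF s] by (auto intro!: derivative_eq_intros simp: has_vector_derivative_def)
  then have "((\<lambda>s. 1) has_derivative (\<lambda>h. \<beta> s \<bullet> (h *\<^sub>R \<beta>1 s) + (h *\<^sub>R \<beta>1 s) \<bullet> \<beta> s)) (at s)"
    by (rule has_derivative_transform_within_open[OF _ I(1) s]) (simp add: dot_square_norm unit)
  then have "(\<lambda>h. \<beta> s \<bullet> (h *\<^sub>R \<beta>1 s) + (h *\<^sub>R \<beta>1 s) \<bullet> \<beta> s) = (\<lambda>h. 0)"
    using has_derivative_const has_derivative_unique by blast
  from fun_cong[OF this, of 1] have b01: "\<beta> s \<bullet> \<beta>1 s = 0" by (simp add: inner_commute)
  have b00: "\<beta> s \<bullet> \<beta> s = 1" using unit[OF s] by (simp add: dot_square_norm)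
  have N: "N = cross3 (X1 u) (X2 u)"
    using X1[OF u(1)] X2[OF u(1)] u by (simp add: N_def ruled_map_def)
  define r where "r = sqrt (N \<bullet> N)"
  have N0: "N \<noteq> 0" using normal_nonzero[OF u(1)] by (simp add: N)
  then have r: "r > 0" "N \<bullet> N = r ^ 2" by (simp_all add: r_def)
  have n: "n u = inverse r *\<^sub>R N" by (simp add: unit_normal_alt N r_def)
  \<comment> \<open>\<open>\<beta>1 s\<close> is orthogonal to its cross product with
    \<open>\<beta> s\<close>, so \<open>t\<close> drops out.\<close>
  have d: "\<beta>1 s \<bullet> N = \<delta>"
    by (simp add: N_def \<delta>_def cross_add_left inner_add_right cross_mult_left dot_cross_self)
  let ?h = "second_form (ruled_map \<alpha> \<beta>) u" and ?g = "first_form (ruled_map \<alpha> \<beta>) u"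
  have h: "?h $1$1 = ((\<alpha>2 s + t *\<^sub>R \<beta>2 s) \<bullet> N) / r" "?h $1$2 = \<delta> / r" "?h $2$1 = \<delta> / r" "?h$2$2 = 0"
    by (simp_all add: second_form_def X11 X12 X21 X22 n d divide_inverse)
  have g: "?g $2$2 = 1" "?g $1$2 = \<alpha>1 s \<bullet> \<beta> s"
    using b00 b01 u X1[OF u(1)] X2[OF u(1)]
    by (simp_all add: first_form_def ruled_map_def inner_add_left inner_add_right inner_commute)
  have deth: "det ?h = - \<delta>\<^sup>2 / r\<^sup>2"
    unfolding det_2 h by (simp add: power2_eq_square)
  show "\<delta> \<noteq> 0" using second_form_det_nonzero[OF u(1)] deth by auto
  have "((\<Lambda> *v ruled_map \<alpha> \<beta> u) \<bullet> N) / r * (- \<delta>\<^sup>2 / r\<^sup>2)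
    = - (((\<alpha>2 s + t *\<^sub>R \<beta>2 s) \<bullet> N) / r - (\<alpha>1 s \<bullet> \<beta> s) * (\<delta> / r + \<delta> / r))"
    using beltrami_III_position_normal[OF u(1)] unfolding deth h g eq[OF u(1)] n
    by (simp add: divide_inverse mult_ac)
  then show "((\<Lambda> *v (\<alpha> s + t *\<^sub>R \<beta> s)) \<bullet> N) * \<delta>\<^sup>2
    = (N \<bullet> N) * ((\<alpha>2 s + t *\<^sub>R \<beta>2 s) \<bullet> N - 2 * \<delta> * (\<alpha>1 s \<bullet> \<beta> s))"
    using r u by (simp add: ruled_map_def field_simps power2_eq_square)
qed

section \<open>Quartic identities, orthonormal triples, differentiation of identities\<close>

lemma quartic_coeffs_zero:
  fixes T :: "real set"
  assumes "open T" "T \<noteq> {}"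
    and "\<And>x. x \<in> T \<Longrightarrow> a0 + a1 * x + a2 * x^2 + a3 * x^3 + a4 * x^4 = 0"
  shows "a0 = 0" "a1 = 0" "a2 = 0" "a3 = 0" "a4 = 0"
proof -
  let ?p = "[:a0, a1, a2, a3, a4:]"
  have "T \<subseteq> {x. poly ?p x = 0}"
    using assms(3) by (auto simp: algebra_simps power2_eq_square power3_eq_cube power4_eq_xxxx)
  moreover have "infinite T"
    using assms(1,2) finite_imp_not_open by blast
  ultimately have "?p = 0"
    using poly_roots_finite finite_subset by blast
  then show "a0 = 0" "a1 = 0" "a2 = 0" "a3 = 0" "a4 = 0" by simp_all
qed

lemma orthonormal_cross:
  fixes x y :: "real^3"
  assumes "x \<bullet> x = 1" "y \<bullet> y = 1" "x \<bullet> y = 0"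
  shows "cross3 y (cross3 x y) = x" "cross3 (cross3 x y) x = y" "cross3 x y \<bullet> cross3 x y = 1"
    "z = (z \<bullet> x) *\<^sub>R x + (z \<bullet> y) *\<^sub>R y + (z \<bullet> cross3 x y) *\<^sub>R cross3 x y"
proof -
  show 1: "cross3 y (cross3 x y) = x" using assms by (simp add: Lagrange inner_commute)
  show 2: "cross3 (cross3 x y) x = y"
    using assms cross_skew[of "cross3 x y" x] by (simp add: Lagrange inner_commute)
  show 3: "cross3 x y \<bullet> cross3 x y = 1" using assms by (simp add: dot_cross inner_commute)
  have "(cross3 x y \<bullet> cross3 x y) *\<^sub>R z = (z \<bullet> cross3 y (cross3 x y)) *\<^sub>R x
     + (z \<bullet> cross3 (cross3 x y) x) *\<^sub>R y + (z \<bullet> cross3 x y) *\<^sub>R cross3 x y"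
    by (simp add: cross3_simps forall_3)
  then show "z = (z \<bullet> x) *\<^sub>R x + (z \<bullet> y) *\<^sub>R y + (z \<bullet> cross3 x y) *\<^sub>R cross3 x y"
    by (simp add: 1 2 3)
qed

text \<open>Serves to differentiate an identity that is known only on \<open>J\<close>.\<close>

lemma derivative_zero_on_open:
  fixes f g :: "real \<Rightarrow> real"
  assumes "open J" "s \<in> J" "\<And>x. x \<in> J \<Longrightarrow> f x = g x"
    and "(f has_real_derivative D) (at s)" "(g has_real_derivative E) (at s)"
  shows "D = E"
proof -
  have "(g has_real_derivative D) (at s)"
    using assms has_field_derivative_transform_within_open by blast
  then show ?thesis using assms(5) DERIV_unique by blast
qed

lemma DERIV_inner:
  assumes "(f has_vector_derivative f') (at s)" "(g has_vector_derivative g') (at s)"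
  shows "((\<lambda>s. f s \<bullet> g s) has_real_derivative f' \<bullet> g s + f s \<bullet> g') (at s)"
  using bounded_bilinear.has_vector_derivative[OF bounded_bilinear_inner assms]
  by (simp add: has_real_derivative_iff_has_vector_derivative add.commute)

lemma has_vector_derivative_matrix_vector:
  fixes A :: "real^'n^'m"
  assumes "(f has_vector_derivative f') F"
  shows "((\<lambda>s. A *v f s) has_vector_derivative A *v f') F"
  using bounded_linear.has_vector_derivative[OF matrix_vector_mul_bounded_linear assms] .

text \<open>The axis passes through \<open>b\<close> in direction \<open>cross3 x y\<close>;
  \<sigma> is the angle, \<tau> the signed distance from the axis along the ruling, \<open>h\<close>
  the rise per radian.\<close>

definition helicoid_point :: "real \<Rightarrow> real^3 \<Rightarrow> real^3 \<Rightarrow> real^3 \<Rightarrow> real \<Rightarrow> real \<Rightarrow> real^3" where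
  "helicoid_point h x y b \<sigma> \<tau> = b + \<tau> *\<^sub>R (cos \<sigma> *\<^sub>R x + sin \<sigma> *\<^sub>R y) + (h * \<sigma>) *\<^sub>R cross3 x y"

text \<open>What remains of the surface on a parameter rectangle: curves over \<open>J\<close> and,
  for every \<open>s\<close>, an identity in \<open>t\<close> on one common open set
  \<open>T\<close>. The second derivatives enter merely as functions of \<open>s\<close>.\<close>

locale skew_rulings =
  fixes J T :: "real set" and \<alpha> \<beta> \<alpha>1 \<beta>1 \<alpha>2 \<beta>2 :: "real \<Rightarrow> real^3" and \<Lambda> :: "real^3^3"
  assumes open_J: "open J" and open_T: "open T" and T_nonempty: "T \<noteq> {}"
    and unit: "s \<in> J \<Longrightarrow> \<beta> s \<bullet> \<beta> s = 1"
    and der: "s \<in> J \<Longrightarrow> (\<alpha> has_vector_derivative \<alpha>1 s) (at s)"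
      "s \<in> J \<Longrightarrow> (\<beta> has_vector_derivative \<beta>1 s) (at s)"
      "s \<in> J \<Longrightarrow> (\<alpha>1 has_vector_derivative \<alpha>2 s) (at s)"
      "s \<in> J \<Longrightarrow> (\<beta>1 has_vector_derivative \<beta>2 s) (at s)"
    and skew: "s \<in> J \<Longrightarrow> \<beta>1 s \<bullet> cross3 (\<alpha>1 s) (\<beta> s) \<noteq> 0"
    and eigen: "s \<in> J \<Longrightarrow> t \<in> T \<Longrightarrow>
      (let N = cross3 (\<alpha>1 s + t *\<^sub>R \<beta>1 s) (\<beta> s); \<delta> = \<beta>1 s \<bullet> cross3 (\<alpha>1 s) (\<beta> s) in
        ((\<Lambda> *v (\<alpha> s + t *\<^sub>R \<beta> s)) \<bullet> N) * \<delta>\<^sup>2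
          = (N \<bullet> N) * ((\<alpha>2 s + t *\<^sub>R \<beta>2 s) \<bullet> N - 2 * \<delta> * (\<alpha>1 s \<bullet> \<beta> s)))"
begin

text \<open>\<open>\<rho>\<close> is the speed of the spherical curve \<beta>. Division by it makes
  \<open>a\<close>, \<open>b\<close>, \<open>P\<close> the frame components of the derivative of
  \<alpha> by the arc length of \<beta>. \<open>P\<close> is the distribution parameter, and
  \<open>t = - b s\<close> is the striction point on the ruling.\<close>

definition "\<rho> s = norm (\<beta>1 s)"
definition "v s = inverse (\<rho> s) *\<^sub>R \<beta>1 s"
definition "w s = cross3 (\<beta> s) (v s)"
definition "a s = (\<alpha>1 s \<bullet> \<beta> s) / \<rho> s"
definition "b s = (\<alpha>1 s \<bullet> v s) / \<rho> s"
definition "P s = (\<alpha>1 s \<bullet> w s) / \<rho> s"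
definition "\<gamma> s = \<alpha> s - b s *\<^sub>R \<beta> s"
text \<open>\<open>has_derivative_gamma\<close> shows that this is the \<open>c\<close> of the
  overview, per arc length of \<beta>. In this form it can be differentiated repeatedly, while
  \<open>a\<close> and \<open>b\<close> contain \<open>\<alpha>1\<close>, of which a single
  derivative is at hand.\<close>

definition "c s = - P s * ((\<Lambda> *v \<beta> s) \<bullet> w s)"

context
  fixes s assumes s: "s \<in> J"
begin

lemma rho_pos: "\<rho> s > 0"
  using skew[OF s] by (auto simp: \<rho>_def)

lemma beta1_eq: "\<beta>1 s = \<rho> s *\<^sub>R v s"
  using rho_pos by (simp add: v_def)

lemma beta_beta1: "\<beta> s \<bullet> \<beta>1 s = 0"
  using derivative_zero_on_open[OF open_J s unit DERIV_inner[OF der(2)[OF s] der(2)[OF s]] DERIV_const]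
  by (simp add: inner_commute)

lemma frame: "\<beta> s \<bullet> v s = 0" "v s \<bullet> v s = 1" "\<beta> s \<bullet> w s = 0" "v s \<bullet> w s = 0" "w s \<bullet> w s = 1"
  "v s \<bullet> \<beta> s = 0" "w s \<bullet> v s = 0" "w s \<bullet> \<beta> s = 0" "\<beta> s \<bullet> \<beta> s = 1"
proof -
  show 1: "\<beta> s \<bullet> v s = 0" by (simp add: v_def beta_beta1)
  show 2: "v s \<bullet> v s = 1" using rho_pos
    by (simp add: v_def dot_square_norm \<rho>_def power2_eq_square)
  show "w s \<bullet> w s = 1" using orthonormal_cross(3)[OF unit[OF s] 2 1] by (simp add: w_def)
  show "v s \<bullet> \<beta> s = 0" using 1 by (simp add: inner_commute)
qed (simp_all add: w_def dot_cross_self unit[OF s])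

lemma expand: "z = (z \<bullet> \<beta> s) *\<^sub>R \<beta> s + (z \<bullet> v s) *\<^sub>R v s + (z \<bullet> w s) *\<^sub>R w s"
  using orthonormal_cross(4)[OF unit[OF s] frame(2,1)] by (simp add: w_def)

lemma cross_frame: "cross3 (v s) (\<beta> s) = - w s" "cross3 (w s) (\<beta> s) = v s" 
  using orthonormal_cross(2)[OF unit[OF s] frame(2,1)] cross_skew[of "v s" "\<beta> s"] by (simp_all add: w_def)

lemma alpha1_eq: "\<alpha>1 s = \<rho> s *\<^sub>R (a s *\<^sub>R \<beta> s + b s *\<^sub>R v s + P s *\<^sub>R w s)"
  using expand[of "\<alpha>1 s"] rho_pos by (simp add: a_def b_def P_def scaleR_add_right)

text \<open>Splits the nonvanishing determinant into the speed and the distribution parameter, so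
  that \<open>P\<close> is nonzero.\<close>

lemma distribution: "\<beta>1 s \<bullet> cross3 (\<alpha>1 s) (\<beta> s) = (\<rho> s)\<^sup>2 * P s"
  by (simp add: alpha1_eq beta1_eq cross_mult_left cross_add_left cross_frame frame inner_add_right inner_diff_right power2_eq_square)

lemma P_nonzero: "P s \<noteq> 0"
  using distribution skew[OF s] by auto

lemma normal_eq:
  "cross3 (\<alpha>1 s + t *\<^sub>R \<beta>1 s) (\<beta> s) = \<rho> s *\<^sub>R (P s *\<^sub>R v s - (b s + t) *\<^sub>R w s)"
  by (simp add: alpha1_eq beta1_eq cross_mult_left cross_add_left cross_frame algebra_simps)

text \<open>In the coordinate \<open>\<tau> = t + b\<close> measured from the striction curve \<open>\<gamma>\<close> the eigenvalue
  equation is a polynomial identity of degree four in \<open>\<tau>\<close>.\<close>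

lemma coefficients:
  "\<beta>2 s \<bullet> w s = 0"
  "P s * (\<beta>2 s \<bullet> v s) = \<alpha>2 s \<bullet> w s"
  "P s * ((\<Lambda> *v \<beta> s) \<bullet> v s) = (\<Lambda> *v \<gamma> s) \<bullet> w s"
  "(\<Lambda> *v \<gamma> s) \<bullet> v s = c s"
  "\<alpha>2 s \<bullet> v s - b s * (\<beta>2 s \<bullet> v s) - 2 * (\<rho> s)\<^sup>2 * a s = (\<rho> s)\<^sup>2 * c s"
proof -
  define p1 p2 q1 q2 where "p1 = \<alpha>2 s \<bullet> v s" and "p2 = \<alpha>2 s \<bullet> w s"
    and "q1 = \<beta>2 s \<bullet> v s" and "q2 = \<beta>2 s \<bullet> w s"
  define l1 l2 l3 l4 where "l1 = (\<Lambda> *v \<beta> s) \<bullet> v s" and "l2 = (\<Lambda> *v \<beta> s) \<bullet> w s"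
    and "l3 = (\<Lambda> *v \<gamma> s) \<bullet> v s" and "l4 = (\<Lambda> *v \<gamma> s) \<bullet> w s"
  define A B R pp where "A = a s" and "B = b s" and "R = \<rho> s" and "pp = P s"
  note defs = p1_def p2_def q1_def q2_def l1_def l2_def l3_def l4_def A_def B_def R_def pp_def
  have nz: "R \<noteq> 0" "pp \<noteq> 0" using rho_pos P_nonzero by (auto simp: defs)
  \<comment> \<open>\<open>x\<close> is the coordinate \<tau>; a common factor \<open>R^3\<close> of
    both sides has been cancelled.\<close>
  have main: "(pp * l3 + x * (pp * l1 - l4) - x^2 * l2) * (R^2 * pp^2)
      = (pp^2 + x^2) * (pp * (p1 + (x - B) * q1) - x * (p2 + (x - B) * q2) - 2 * R^2 * pp * A)"
    if "x - B \<in> T" for x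
  proof -
    define t where "t = x - B"
    have x: "x = b s + t" by (simp add: t_def B_def)
    define n where "n = P s *\<^sub>R v s - x *\<^sub>R w s"
    have "\<alpha> s + t *\<^sub>R \<beta> s = \<gamma> s + x *\<^sub>R \<beta> s"
      by (simp add: \<gamma>_def x algebra_simps)
    then have L: "(\<Lambda> *v (\<alpha> s + t *\<^sub>R \<beta> s)) \<bullet> n = pp * l3 + x * (pp * l1 - l4) - x^2 * l2"
      by (simp add: n_def matrix_vector_right_distrib matrix_vector_mult_scaleR inner_add_left
          inner_diff_right defs algebra_simps power2_eq_square)
    have N: "n \<bullet> n = pp^2 + x^2"
      by (simp add: n_def inner_diff_left inner_diff_right frame defs power2_eq_square)
    have K: "(\<alpha>2 s + t *\<^sub>R \<beta>2 s) \<bullet> n = pp * (p1 + t * q1) - x * (p2 + t * q2)"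
      by (simp add: n_def inner_add_left inner_diff_right defs algebra_simps)
    have al: "\<alpha>1 s \<bullet> \<beta> s = R * A" using rho_pos by (simp add: a_def defs)
    have "R * ((\<Lambda> *v (\<alpha> s + t *\<^sub>R \<beta> s)) \<bullet> n) * (R^2 * pp)^2
        = R * R * (n \<bullet> n) * (R * ((\<alpha>2 s + t *\<^sub>R \<beta>2 s) \<bullet> n) - 2 * (R^2 * pp) * (R * A))"
      using eigen[OF s that] unfolding Let_def normal_eq distribution t_def[symmetric] x[symmetric] n_def[symmetric] al
      by (simp add: R_def[symmetric] pp_def[symmetric] mult.assoc)
    then have "R^3 * ((\<Lambda> *v (\<alpha> s + t *\<^sub>R \<beta> s)) \<bullet> n * (R^2 * pp^2))
        = R^3 * ((n \<bullet> n) * ((\<alpha>2 s + t *\<^sub>R \<beta>2 s) \<bullet> n - 2 * R^2 * pp * A))"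
      by (simp add: power2_eq_square power3_eq_cube algebra_simps)
    then show ?thesis
      using nz unfolding L N K unfolding t_def by simp
  qed
  define C where "C = p1 - B * q1 - 2 * R^2 * A"
  have "open ((\<lambda>t. t + B) ` T)" using open_T by (rule open_translation_subtract[of _ "-B", simplified])
  then have o: "open ((\<lambda>t. t + B) ` T)" "(\<lambda>t. t + B) ` T \<noteq> {}" using T_nonempty by auto
  have "(pp^3 * C - pp^3 * l3 * R^2) + (pp^2 * (pp * q1 - p2 + B * q2) - (pp * l1 - l4) * R^2 * pp^2) * x
      + (pp * C - pp^2 * q2 + l2 * R^2 * pp^2) * x^2 + (pp * q1 - p2 + B * q2) * x^3 + (- q2) * x^4 = 0"
    if "x \<in> (\<lambda>t. t + B) ` T" for x
    using main[of x] that unfolding C_def by (auto simp: algebra_simps power2_eq_square power3_eq_cube power4_eq_xxxx)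
  note z = quartic_coeffs_zero[OF o this]
  show 1: "\<beta>2 s \<bullet> w s = 0" using z(5) by (simp add: defs)
  then have q2: "q2 = 0" by (simp add: defs)
  then show "P s * (\<beta>2 s \<bullet> v s) = \<alpha>2 s \<bullet> w s" using z(4) by (simp add: defs)
  \<comment> \<open>The linear coefficient contains \<open>pp^2\<close> times the cubic one, which
    vanishes.\<close>
  have "(pp * l1 - l4) * R^2 * pp^2 = 0" using z(2,4) by simp
  then show "P s * ((\<Lambda> *v \<beta> s) \<bullet> v s) = (\<Lambda> *v \<gamma> s) \<bullet> w s" using nz by (simp add: defs)
  have "pp^3 * (C - l3 * R^2) = 0" using z(1) by (simp add: algebra_simps)
  \<comment> \<open>The constant and the quadratic coefficient give two values for \<open>C\<close>;
    equating them yields \<open>l3 = - pp * l2\<close>, which is \<open>c s\<close>.\<close>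
  then have C1: "C = l3 * R^2" using nz by simp
  have "pp * (C + l2 * R^2 * pp) = 0" using z(3) q2 by (simp add: algebra_simps power2_eq_square)
  then have C2: "C = - l2 * R^2 * pp" using nz by simp
  have "c s = - pp * l2" by (simp add: c_def defs)
  moreover have "l3 * R^2 = - pp * l2 * R^2" using C1 C2 by (simp add: algebra_simps)
  then have "(l3 + pp * l2) * R^2 = 0" by (simp add: algebra_simps)
  then have "l3 = - pp * l2" using nz by simp
  ultimately show c: "(\<Lambda> *v \<gamma> s) \<bullet> v s = c s" by (simp add: defs)
  show "\<alpha>2 s \<bullet> v s - b s * (\<beta>2 s \<bullet> v s) - 2 * (\<rho> s)\<^sup>2 * a s = (\<rho> s)\<^sup>2 * c s"
    using C1 c by (simp add: C_def defs mult.commute)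
qed

end


section \<open>Motion of the frame, of the distribution parameter and of the striction curve\<close>

lemma has_derivative_rho: 
  assumes s: "s \<in> J"
  shows "(\<rho> has_real_derivative \<beta>2 s \<bullet> v s) (at s)"
proof -
  have pos: "\<beta>1 s \<bullet> \<beta>1 s > 0" using rho_pos[OF s] by (simp add: \<rho>_def)
  have "\<rho> = (\<lambda>s. sqrt (\<beta>1 s \<bullet> \<beta>1 s))" by (simp add: \<rho>_def norm_eq_sqrt_inner fun_eq_iff)
  then show ?thesis
    using DERIV_chain2[of sqrt, OF DERIV_real_sqrt[OF pos] DERIV_inner[OF der(4)[OF s] der(4)[OF s]]]
    by (simp add: v_def inner_commute mult.commute)
qed

text \<open>The quartic coefficient removes the \<open>w\<close> component: \<beta> runs on a great
  circle, which is what makes \<open>w\<close> constant.\<close>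

lemma beta2_eq:
  assumes s: "s \<in> J"
  shows "\<beta>2 s = - (\<rho> s)\<^sup>2 *\<^sub>R \<beta> s + (\<beta>2 s \<bullet> v s) *\<^sub>R v s"
proof -
  have "\<beta>1 s \<bullet> \<beta>1 s + \<beta> s \<bullet> \<beta>2 s = 0"
    using derivative_zero_on_open[OF open_J s beta_beta1 DERIV_inner[OF der(2)[OF s] der(4)[OF s]] DERIV_const] .
  then have "\<beta>2 s \<bullet> \<beta> s = - (\<rho> s)\<^sup>2"
    by (simp add: dot_square_norm \<rho>_def inner_commute)
  then show ?thesis
    using expand[OF s, of "\<beta>2 s"] coefficients(1)[OF s] by simp
qed

text \<open>The component of \<open>\<beta>2\<close> along \<open>v\<close> is the derivative of
  \<open>\<rho>\<close>, so it cancels against the derivative of 1/\<rho>.\<close>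

lemma has_derivative_v:
  assumes s: "s \<in> J"
  shows "(v has_vector_derivative (- \<rho> s) *\<^sub>R \<beta> s) (at s)"
proof -
  let ?q = "\<beta>2 s \<bullet> v s"
  have v: "v = (\<lambda>s. inverse (\<rho> s) *\<^sub>R \<beta>1 s)" by (simp add: v_def fun_eq_iff)
  have 1: "((\<lambda>s. inverse (\<rho> s) *\<^sub>R \<beta>1 s) has_vector_derivative
      inverse (\<rho> s) *\<^sub>R \<beta>2 s + (- (inverse (\<rho> s) * ?q * inverse (\<rho> s))) *\<^sub>R \<beta>1 s) (at s)"
    by (intro has_vector_derivative_scaleR DERIV_inverse' has_derivative_rho[OF s] der(4)[OF s])
      (use rho_pos[OF s] in simp)
  have "inverse R *\<^sub>R (- R\<^sup>2 *\<^sub>R x + q *\<^sub>R y) + (- (inverse R * q * inverse R)) *\<^sub>R (R *\<^sub>R y) = (- R) *\<^sub>R x"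
    if "R > 0" for R q :: real and x y :: "real^3"
    using that by (simp add: vec_eq_iff field_simps power2_eq_square)
  from this[OF rho_pos[OF s], of "\<beta> s" ?q "v s", folded beta2_eq[OF s] beta1_eq[OF s]]
  show ?thesis using 1 unfolding v[symmetric] by simp
qed

lemma has_derivative_beta:
  assumes s: "s \<in> J"
  shows "(\<beta> has_vector_derivative \<rho> s *\<^sub>R v s) (at s)"
  using der(2)[OF s] by (simp add: beta1_eq[OF s])

lemma has_derivative_w:
  assumes s: "s \<in> J"
  shows "(w has_vector_derivative 0) (at s)"
  using bounded_bilinear.has_vector_derivative[OF bounded_bilinear_cross3
      has_derivative_beta[OF s] has_derivative_v[OF s]]
  by (simp add: w_def[abs_def] cross_mult_left cross_mult_right cross_refl)

text \<open>The numerator of the quotient rule is \<open>\<rho> s\<close> times the difference that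
  the cubic coefficient makes zero.\<close>

lemma has_derivative_P:
  assumes s: "s \<in> J"
  shows "(P has_real_derivative 0) (at s)"
proof -
  have "(P has_real_derivative ((\<alpha>2 s \<bullet> w s + \<alpha>1 s \<bullet> 0) * \<rho> s - (\<alpha>1 s \<bullet> w s) * (\<beta>2 s \<bullet> v s)) / (\<rho> s * \<rho> s)) (at s)"
    unfolding P_def[abs_def] using rho_pos[OF s]
    by (intro DERIV_divide DERIV_inner der(3)[OF s] has_derivative_w[OF s] has_derivative_rho[OF s]) simp
  moreover have "(\<alpha>2 s \<bullet> w s) * \<rho> s = (\<alpha>1 s \<bullet> w s) * (\<beta>2 s \<bullet> v s)"
    using coefficients(2)[OF s] rho_pos[OF s] by (simp add: P_def field_simps)
  ultimately show ?thesis by simp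
qed

text \<open>The last of the \<open>coefficients\<close> eliminates the component of
  \<open>\<alpha>2\<close> along \<open>v\<close>, and the second derivative of \<beta> cancels with
  it.\<close>

lemma has_derivative_b:
  assumes s: "s \<in> J"
  shows "(b has_real_derivative \<rho> s * (a s + c s)) (at s)"
proof -
  have "(b has_real_derivative ((\<alpha>2 s \<bullet> v s + \<alpha>1 s \<bullet> ((- \<rho> s) *\<^sub>R \<beta> s)) * \<rho> s
      - (\<alpha>1 s \<bullet> v s) * (\<beta>2 s \<bullet> v s)) / (\<rho> s * \<rho> s)) (at s)"
    unfolding b_def[abs_def] using rho_pos[OF s]
    by (intro DERIV_divide DERIV_inner der(3)[OF s] has_derivative_v[OF s] has_derivative_rho[OF s]) simp
  moreover have "((\<alpha>2 s \<bullet> v s + \<alpha>1 s \<bullet> ((- \<rho> s) *\<^sub>R \<beta> s)) * \<rho> s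
      - (\<alpha>1 s \<bullet> v s) * (\<beta>2 s \<bullet> v s)) / (\<rho> s * \<rho> s) = \<rho> s * (a s + c s)"
  proof -
    have 1: "\<alpha>1 s \<bullet> v s = b s * \<rho> s" "\<alpha>1 s \<bullet> \<beta> s = a s * \<rho> s"
      using rho_pos[OF s] by (simp_all add: a_def b_def)
    have 2: "\<alpha>2 s \<bullet> v s = b s * (\<beta>2 s \<bullet> v s) + 2 * (\<rho> s)\<^sup>2 * a s + (\<rho> s)\<^sup>2 * c s"
      using coefficients(5)[OF s] by simp
    show ?thesis using rho_pos[OF s] by (simp add: 1 2 field_simps power2_eq_square)
  qed
  ultimately show ?thesis by simp
qed

text \<open>Subtracting \<open>b s *\<^sub>R \<beta> s\<close> cancels the component along
  \<open>v\<close>, which characterises the striction curve, and \<open>b'\<close> replaces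
  \<open>a\<close> by \<open>- c\<close>.\<close>

lemma has_derivative_gamma:
  assumes s: "s \<in> J"
  shows "(\<gamma> has_vector_derivative \<rho> s *\<^sub>R (P s *\<^sub>R w s - c s *\<^sub>R \<beta> s)) (at s)"
proof -
  have "(\<gamma> has_vector_derivative \<alpha>1 s - (b s *\<^sub>R (\<rho> s *\<^sub>R v s) + (\<rho> s * (a s + c s)) *\<^sub>R \<beta> s)) (at s)"
    unfolding \<gamma>_def[abs_def]
    by (intro has_vector_derivative_diff has_vector_derivative_scaleR der(1)[OF s]
        has_derivative_b[OF s] has_derivative_beta[OF s])
  then show ?thesis by (simp add: alpha1_eq[OF s] algebra_simps)
qed

lemma DERIV_form:
  assumes "(f has_vector_derivative f') (at s)" "(g has_vector_derivative g') (at s)"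
  shows "((\<lambda>s. (\<Lambda> *v f s) \<bullet> g s) has_real_derivative (\<Lambda> *v f') \<bullet> g s + (\<Lambda> *v f s) \<bullet> g') (at s)"
  by (intro DERIV_inner has_vector_derivative_matrix_vector assms)

text \<open>Differentiating the coefficient relations with respect to the arc length of \<open>\<beta>\<close>
  gives \<open>c\<^sup>3 = 3 c d\<^sup>2\<close> for the derivative \<open>d\<close> of \<open>c\<close>; the left-hand side
  minus the right-hand side is the real part of \<open>(c + i d)\<^sup>3\<close>, which rotates, so it
  vanishes identically only if \<open>c = 0\<close>.\<close>

lemma c_eq_0:
  assumes s: "s \<in> J"
  shows "c s = 0"
proof -
  \<comment> \<open>The entries of \<Lambda> in the frame and one component of \<Lambda>\<gamma>;
    \<open>d\<close> is the derivative of \<open>c\<close> by the arc length of \<beta>.\<close>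
  define d p q r r2 l m z \<mu> where "d s = - P s * ((\<Lambda> *v v s) \<bullet> w s)"
    and "p s = (\<Lambda> *v \<beta> s) \<bullet> \<beta> s" and "q s = (\<Lambda> *v v s) \<bullet> v s"
    and "r s = (\<Lambda> *v \<beta> s) \<bullet> v s" and "r2 s = (\<Lambda> *v v s) \<bullet> \<beta> s"
    and "l s = (\<Lambda> *v w s) \<bullet> \<beta> s" and "m s = (\<Lambda> *v w s) \<bullet> v s"
    and "z s = (\<Lambda> *v \<gamma> s) \<bullet> \<beta> s" and "\<mu> s = (\<Lambda> *v w s) \<bullet> w s" for s
  note fdefs = d_def[abs_def] p_def[abs_def] q_def[abs_def] r_def[abs_def] r2_def[abs_def] l_def[abs_def]
    m_def[abs_def] z_def[abs_def] \<mu>_def[abs_def] c_def[abs_def]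
  have neg: "\<Lambda> *v (- x) = - (\<Lambda> *v x)" for x
    by (rule linear_neg[OF matrix_vector_mul_linear])
  note msimps = neg matrix_vector_mult_scaleR matrix_vector_right_distrib matrix_vector_mult_diff_distrib
    inner_add_left inner_diff_left algebra_simps
  \<comment> \<open>Each derivative is \<rho> times an expression in the same functions: the system
    is closed.\<close>
  have D: "(c has_real_derivative \<rho> x * d x) (at x)" "(d has_real_derivative \<rho> x * (- c x)) (at x)"
    "(p has_real_derivative \<rho> x * (r x + r2 x)) (at x)" "(q has_real_derivative \<rho> x * (- r x - r2 x)) (at x)"
    "(r has_real_derivative \<rho> x * (q x - p x)) (at x)" "(r2 has_real_derivative \<rho> x * (q x - p x)) (at x)"
    "(l has_real_derivative \<rho> x * m x) (at x)" "(m has_real_derivative \<rho> x * (- l x)) (at x)"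
    "(\<mu> has_real_derivative \<rho> x * 0) (at x)"
    "((\<lambda>s. (\<Lambda> *v \<gamma> s) \<bullet> w s) has_real_derivative \<rho> x * (P x * \<mu> x + (c x)\<^sup>2 / P x)) (at x)"
    "((\<lambda>s. (\<Lambda> *v \<gamma> s) \<bullet> v s) has_real_derivative \<rho> x * (P x * m x - c x * r x - z x)) (at x)"
    "(z has_real_derivative \<rho> x * (P x * l x - c x * p x + (\<Lambda> *v \<gamma> x) \<bullet> v x)) (at x)"
    "(P has_real_derivative \<rho> x * 0) (at x)"
    if x: "x \<in> J" for x
  proof -
    note b' = has_derivative_beta[OF x] and v' = has_derivative_v[OF x] and w' = has_derivative_w[OF x]
      and g' = has_derivative_gamma[OF x] and P' = has_derivative_P[OF x]
    have "P x \<noteq> 0" by (rule P_nonzero[OF x])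
    then have c2: "c x * ((\<Lambda> *v \<beta> x) \<bullet> w x) = - ((c x)\<^sup>2 / P x)"
      by (simp add: c_def power2_eq_square)
    show "(c has_real_derivative \<rho> x * d x) (at x)"
      unfolding fdefs by (rule DERIV_cong[OF DERIV_mult[OF DERIV_minus[OF P'] DERIV_form[OF b' w']]]) (simp add: msimps)
    show "(d has_real_derivative \<rho> x * (- c x)) (at x)"
      unfolding fdefs by (rule DERIV_cong[OF DERIV_mult[OF DERIV_minus[OF P'] DERIV_form[OF v' w']]]) (simp add: msimps)
    show "(p has_real_derivative \<rho> x * (r x + r2 x)) (at x)"
      unfolding fdefs by (rule DERIV_cong[OF DERIV_form[OF b' b']]) (simp add: msimps)
    show "(q has_real_derivative \<rho> x * (- r x - r2 x)) (at x)"
      unfolding fdefs by (rule DERIV_cong[OF DERIV_form[OF v' v']]) (simp add: msimps)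
    show "(r has_real_derivative \<rho> x * (q x - p x)) (at x)"
      unfolding fdefs by (rule DERIV_cong[OF DERIV_form[OF b' v']]) (simp add: msimps)
    show "(r2 has_real_derivative \<rho> x * (q x - p x)) (at x)"
      unfolding fdefs by (rule DERIV_cong[OF DERIV_form[OF v' b']]) (simp add: msimps)
    show "(l has_real_derivative \<rho> x * m x) (at x)"
      unfolding fdefs by (rule DERIV_cong[OF DERIV_form[OF w' b']]) (simp add: msimps)
    show "(m has_real_derivative \<rho> x * (- l x)) (at x)"
      unfolding fdefs by (rule DERIV_cong[OF DERIV_form[OF w' v']]) (simp add: msimps)
    show "(\<mu> has_real_derivative \<rho> x * 0) (at x)"
      unfolding fdefs by (rule DERIV_cong[OF DERIV_form[OF w' w']]) (simp add: msimps)
    show "((\<lambda>s. (\<Lambda> *v \<gamma> s) \<bullet> w s) has_real_derivative \<rho> x * (P x * \<mu> x + (c x)\<^sup>2 / P x)) (at x)"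
      by (rule DERIV_cong[OF DERIV_form[OF g' w']]) (simp add: msimps \<mu>_def c2)
    show "((\<lambda>s. (\<Lambda> *v \<gamma> s) \<bullet> v s) has_real_derivative \<rho> x * (P x * m x - c x * r x - z x)) (at x)"
      by (rule DERIV_cong[OF DERIV_form[OF g' v']]) (simp add: msimps m_def r_def z_def)
    show "(z has_real_derivative \<rho> x * (P x * l x - c x * p x + (\<Lambda> *v \<gamma> x) \<bullet> v x)) (at x)"
      unfolding z_def[abs_def]
      by (rule DERIV_cong[OF DERIV_form[OF g' b']]) (simp add: msimps l_def p_def)
    show "(P has_real_derivative \<rho> x * 0) (at x)" using P' by simp
  qed
  \<comment> \<open>Differentiates an identity on \<open>J\<close> and cancels \<rho>; from here on
    derivatives are by the arc length of \<beta>.\<close>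
  have eq: "A = B"
    if x: "x \<in> J" and fg: "\<And>y. y \<in> J \<Longrightarrow> f y = g y"
      and "(f has_real_derivative \<rho> x * A) (at x)" "(g has_real_derivative \<rho> x * B) (at x)"
    for x A B :: real and f g
    using derivative_zero_on_open[OF open_J x fg that(3,4)] rho_pos[OF x] by simp
  \<comment> \<open>The two relations to be differentiated. \<open>1\<close> produces
    \<open>3\<close>, \<open>6\<close>, \<open>7\<close>, and \<open>2\<close> produces
    \<open>4\<close>, \<open>5\<close>, \<open>8\<close>, \<open>9\<close>, each from the one before
    it.\<close>
  have 1: "P x * r x = (\<Lambda> *v \<gamma> x) \<bullet> w x" and 2: "(\<Lambda> *v \<gamma> x) \<bullet> v x = c x" if "x \<in> J" for x
    using coefficients[OF that] by (simp_all add: r_def)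
  have 3: "(c x)\<^sup>2 + (P x)\<^sup>2 * \<mu> x = (P x)\<^sup>2 * (q x - p x)" if x: "x \<in> J" for x
  proof -
    have "((\<lambda>x. P x * r x) has_real_derivative \<rho> x * (P x * (q x - p x))) (at x)"
      by (rule DERIV_cong[OF DERIV_mult[OF D(13,5)[OF x]]]) (simp add: algebra_simps)
    from eq[OF x 1 this D(10)[OF x]] show ?thesis
      using P_nonzero[OF x] by (simp add: field_simps power2_eq_square)
  qed
  have 4: "P x * m x - c x * r x - z x = d x" if x: "x \<in> J" for x
    by (rule eq[OF x 2 D(11)[OF x] D(1)[OF x]])
  have 5: "d x * r x + c x * q x - 2 * c x * p x + 2 * P x * l x = 0" if x: "x \<in> J" for x
  proof -
    have "((\<lambda>x. P x * m x - c x * r x - z x) has_real_derivative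
        \<rho> x * (- P x * l x - (d x * r x + c x * (q x - p x)) - (P x * l x - c x * p x + c x))) (at x)"
      by (rule DERIV_cong[OF DERIV_diff[OF DERIV_diff[OF DERIV_mult[OF D(13,8)[OF x]] DERIV_mult[OF D(1,5)[OF x]]] D(12)[OF x]]])
        (simp add: 2[OF x] algebra_simps)
    from eq[OF x 4 this D(2)[OF x]] show ?thesis by (simp add: algebra_simps)
  qed
  have 6: "2 * c x * d x = - 2 * (P x)\<^sup>2 * (r x + r2 x)" if x: "x \<in> J" for x
  proof -
    have A: "((\<lambda>x. c x * c x + P x * P x * \<mu> x) has_real_derivative \<rho> x * (2 * c x * d x)) (at x)"
      by (rule DERIV_cong[OF DERIV_add[OF DERIV_mult[OF D(1,1)[OF x]]
          DERIV_mult[OF DERIV_mult[OF D(13,13)[OF x]] D(9)[OF x]]]]) (simp add: algebra_simps)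
    have B: "((\<lambda>x. P x * P x * (q x - p x)) has_real_derivative \<rho> x * (- 2 * (P x)\<^sup>2 * (r x + r2 x))) (at x)"
      by (rule DERIV_cong[OF DERIV_mult[OF DERIV_mult[OF D(13,13)[OF x]] DERIV_diff[OF D(4,3)[OF x]]]])
        (simp add: algebra_simps power2_eq_square)
    show ?thesis
      by (rule eq[OF x _ A B]) (rule 3[unfolded power2_eq_square])
  qed
  have 7: "2 * (d x * d x) - 2 * (c x * c x) = - 4 * (P x)\<^sup>2 * (q x - p x)" if x: "x \<in> J" for x
  proof -
    have A: "((\<lambda>x. 2 * c x * d x) has_real_derivative \<rho> x * (2 * (d x * d x) - 2 * (c x * c x))) (at x)"
      by (rule DERIV_cong[OF DERIV_mult[OF DERIV_mult[OF DERIV_const D(1)[OF x]] D(2)[OF x]]])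
        (simp add: algebra_simps)
    have B: "((\<lambda>x. - 2 * (P x * P x) * (r x + r2 x)) has_real_derivative \<rho> x * (- 4 * (P x)\<^sup>2 * (q x - p x))) (at x)"
      by (rule DERIV_cong[OF DERIV_mult[OF DERIV_mult[OF DERIV_const DERIV_mult[OF D(13,13)[OF x]]] DERIV_add[OF D(5,6)[OF x]]]])
        (simp add: algebra_simps power2_eq_square)
    show ?thesis
      by (rule eq[OF x _ A B]) (rule 6[unfolded power2_eq_square])
  qed
  have 8: "2 * d x * q x - 4 * c x * r x - 3 * c x * r2 x - 3 * d x * p x + 2 * P x * m x = 0"
    if x: "x \<in> J" for x
  proof -
    have A: "((\<lambda>x. d x * r x + c x * q x - 2 * c x * p x + 2 * P x * l x) has_real_derivative
        \<rho> x * (2 * d x * q x - 4 * c x * r x - 3 * c x * r2 x - 3 * d x * p x + 2 * P x * m x)) (at x)"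
      by (rule DERIV_cong[OF DERIV_add[OF DERIV_diff[OF DERIV_add[OF DERIV_mult[OF D(2,5)[OF x]] DERIV_mult[OF D(1,4)[OF x]]]
          DERIV_mult[OF DERIV_mult[OF DERIV_const D(1)[OF x]] D(3)[OF x]]]
          DERIV_mult[OF DERIV_mult[OF DERIV_const D(13)[OF x]] D(7)[OF x]]]])
        (simp add: algebra_simps)
    have B: "((\<lambda>x. 0) has_real_derivative \<rho> x * 0) (at x)" by simp
    show ?thesis by (rule eq[OF x _ A B]) (rule 5)
  qed
  have 9: "c x * (10 * p x - 9 * q x) - d x * (9 * r x + 8 * r2 x) - 2 * P x * l x = 0" if x: "x \<in> J" for x
  proof -
    have A: "((\<lambda>x. 2 * d x * q x - 4 * c x * r x - 3 * c x * r2 x - 3 * d x * p x + 2 * P x * m x) has_real_derivative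
        \<rho> x * (c x * (10 * p x - 9 * q x) - d x * (9 * r x + 8 * r2 x) - 2 * P x * l x)) (at x)"
      by (rule DERIV_cong[OF DERIV_add[OF DERIV_diff[OF DERIV_diff[OF DERIV_diff[OF
          DERIV_mult[OF DERIV_mult[OF DERIV_const D(2)[OF x]] D(4)[OF x]]
          DERIV_mult[OF DERIV_mult[OF DERIV_const D(1)[OF x]] D(5)[OF x]]]
          DERIV_mult[OF DERIV_mult[OF DERIV_const D(1)[OF x]] D(6)[OF x]]]
          DERIV_mult[OF DERIV_mult[OF DERIV_const D(2)[OF x]] D(3)[OF x]]]
          DERIV_mult[OF DERIV_mult[OF DERIV_const D(13)[OF x]] D(8)[OF x]]]])
        (simp add: algebra_simps)
    have B: "((\<lambda>x. 0) has_real_derivative \<rho> x * 0) (at x)" by simp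
    show ?thesis by (rule eq[OF x _ A B]) (rule 8)
  qed
  have 10: "c x * (c x * c x - 3 * (d x * d x)) = 0" if x: "x \<in> J" for x
  proof -
    \<comment> \<open>Adding \<open>5\<close> and \<open>9\<close> eliminates \<open>l\<close> and
      leaves -8 times this expression; \<open>6\<close> and \<open>7\<close> turn it into a
      polynomial in \<open>c\<close> and \<open>d\<close>.\<close>
    have "c x * (q x - p x) + d x * (r x + r2 x) = 0"
      using 5[OF x] 9[OF x] by (simp add: algebra_simps)
    then have E: "(P x)\<^sup>2 * (c x * (q x - p x) + d x * (r x + r2 x)) = 0" by simp
    have A: "2 * ((P x)\<^sup>2 * (q x - p x)) = c x * c x - d x * d x" using 7[OF x] by linarith
    have B: "(P x)\<^sup>2 * (r x + r2 x) = - c x * d x" using 6[OF x] by linarith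
    have "c x * (c x * c x - 3 * (d x * d x))
      = c x * (2 * ((P x)\<^sup>2 * (q x - p x))) + 2 * d x * ((P x)\<^sup>2 * (r x + r2 x))"
      unfolding A B by (simp add: algebra_simps)
    also have "\<dots> = 2 * ((P x)\<^sup>2 * (c x * (q x - p x) + d x * (r x + r2 x)))"
      by (simp add: algebra_simps)
    finally show ?thesis by (simp only: E)
  qed
  have "9 * (c s * c s) * d s - 3 * (d s * d s * d s) = 0"
  proof -
    have 1: "((\<lambda>x. c x * (c x * c x - 3 * (d x * d x))) has_real_derivative
        \<rho> s * (9 * (c s * c s) * d s - 3 * (d s * d s * d s))) (at s)"
      by (rule DERIV_cong[OF DERIV_mult[OF D(1)[OF s] DERIV_diff[OF DERIV_mult[OF D(1,1)[OF s]]
          DERIV_mult[OF DERIV_const DERIV_mult[OF D(2,2)[OF s]]]]]])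
        (simp add: algebra_simps)
    have 2: "((\<lambda>x. 0) has_real_derivative \<rho> s * 0) (at s)" by simp
    show ?thesis
      by (rule eq[OF s _ 1 2]) (rule 10)
  qed
  \<comment> \<open>The imaginary part of (c + i d)^3; together with \<open>10\<close> the whole
    cube vanishes.\<close>
  then have "d s * (3 * (c s * c s) - d s * d s) = 0" by (simp add: algebra_simps)
  with 10[OF s] show ?thesis by (auto simp: algebra_simps)
qed

text \<open>As \<open>c = 0\<close>, the height of \<gamma> along \<open>w\<close> divided by
  \<open>P\<close> grows at the rate \<rho> at which \<beta> turns in the plane orthogonal to
  \<open>w\<close>. It can thus serve as the angle \<phi>: turning \<beta> and \<open>v\<close> back
  by \<phi> gives constant vectors \<open>x\<close> and \<open>y\<close>, which absorb the initial
  phase. The pitch is \<open>P\<close>.\<close>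

lemma contained_in_helicoid:
  assumes "convex J" "J \<noteq> {}"
  obtains h x y p where "h \<noteq> 0" "x \<bullet> x = 1" "y \<bullet> y = 1" "x \<bullet> y = 0"
    "\<And>s t. s \<in> J \<Longrightarrow> \<exists>\<sigma> \<tau>. \<alpha> s + t *\<^sub>R \<beta> s = helicoid_point h x y p \<sigma> \<tau>"
proof -
  obtain s0 where s0: "s0 \<in> J" using assms(2) by auto
  have const: "f s = f s0" if "s \<in> J" and "\<And>s. s \<in> J \<Longrightarrow> (f has_vector_derivative 0) (at s)"
    for f :: "real \<Rightarrow> 'b::real_normed_vector" and s
    using has_vector_derivative_zero_constant[OF assms(1), of f] that s0
    by (metis has_vector_derivative_at_within)
  define \<phi> where "\<phi> s = (\<gamma> s \<bullet> w s) / P s" for s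
  define x where "x s = cos (\<phi> s) *\<^sub>R \<beta> s - sin (\<phi> s) *\<^sub>R v s" for s
  define y where "y s = sin (\<phi> s) *\<^sub>R \<beta> s + cos (\<phi> s) *\<^sub>R v s" for s
  \<comment> \<open>The point where the axis meets the plane through the origin orthogonal to
    \<open>w\<close>.\<close>
  define p where "p s = \<gamma> s - (\<gamma> s \<bullet> w s) *\<^sub>R w s" for s
  have gamma: "(\<gamma> has_vector_derivative (\<rho> s * P s) *\<^sub>R w s) (at s)" if "s \<in> J" for s
    using has_derivative_gamma[OF that] by (simp add: c_eq_0[OF that])
  have gw: "((\<lambda>s. \<gamma> s \<bullet> w s) has_real_derivative \<rho> s * P s) (at s)" if "s \<in> J" for s
    by (rule DERIV_cong[OF DERIV_inner[OF gamma has_derivative_w]]) (simp_all add: that frame)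
  have phi: "(\<phi> has_real_derivative \<rho> s) (at s)" if "s \<in> J" for s
    unfolding \<phi>_def[abs_def] using P_nonzero[OF that]
    by (intro DERIV_cong[OF DERIV_divide[OF gw[OF that] has_derivative_P[OF that]]]) simp_all
  have cphi: "((\<lambda>s. cos (\<phi> s)) has_real_derivative - sin (\<phi> s) * \<rho> s) (at s)"
    and sphi: "((\<lambda>s. sin (\<phi> s)) has_real_derivative cos (\<phi> s) * \<rho> s) (at s)" if "s \<in> J" for s
    using DERIV_chain2[OF DERIV_cos phi[OF that]] DERIV_chain2[OF DERIV_sin phi[OF that]] by simp_all
  have x: "(x has_vector_derivative 0) (at s)" if "s \<in> J" for s
    using has_vector_derivative_diff[OF has_vector_derivative_scaleR[OF cphi[OF that] has_derivative_beta[OF that]]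
        has_vector_derivative_scaleR[OF sphi[OF that] has_derivative_v[OF that]]]
    by (simp add: x_def[abs_def] algebra_simps)
  have y: "(y has_vector_derivative 0) (at s)" if "s \<in> J" for s
    using has_vector_derivative_add[OF has_vector_derivative_scaleR[OF sphi[OF that] has_derivative_beta[OF that]]
        has_vector_derivative_scaleR[OF cphi[OF that] has_derivative_v[OF that]]]
    by (simp add: y_def[abs_def] algebra_simps)
  have p: "(p has_vector_derivative 0) (at s)" if "s \<in> J" for s
    using has_vector_derivative_diff[OF gamma[OF that]
        has_vector_derivative_scaleR[OF gw[OF that] has_derivative_w[OF that]]]
    by (simp add: p_def[abs_def])
  have P': "(P has_vector_derivative 0) (at s)" if "s \<in> J" for s
    using has_derivative_P[OF that] by (simp add: has_real_derivative_iff_has_vector_derivative)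
  have cs: "cos u * cos u + sin u * sin u = 1" for u :: real
    using sin_cos_squared_add2[of u] by (simp add: power2_eq_square)
  have w: "cross3 (x s) (y s) = w s" if "s \<in> J" for s
  proof -
    have "cross3 (x s) (y s) = (cos (\<phi> s) * cos (\<phi> s)) *\<^sub>R w s + (sin (\<phi> s) * sin (\<phi> s)) *\<^sub>R w s"
      using cross_frame(1)[OF that]
      by (simp add: x_def y_def Cross3.left_diff_distrib cross_add_right cross_mult_left cross_mult_right
          w_def[symmetric] cross_refl algebra_simps)
    then show ?thesis by (simp only: scaleR_add_left[symmetric] cs scaleR_one)
  qed
  show thesis
  proof (rule that[of "P s0" "x s0" "y s0" "p s0"])
    show "P s0 \<noteq> 0" by (rule P_nonzero[OF s0])
    show "x s0 \<bullet> x s0 = 1" "y s0 \<bullet> y s0 = 1" "x s0 \<bullet> y s0 = 0"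
      using cs[of "\<phi> s0"] cs[of "\<phi> s0", unfolded add.commute[of "cos _ * cos _"]]
      by (simp_all add: x_def y_def inner_diff_left inner_diff_right inner_add_left inner_add_right frame[OF s0])
    fix s t assume s: "s \<in> J"
    have 1: "\<beta> s = cos (\<phi> s) *\<^sub>R x s + sin (\<phi> s) *\<^sub>R y s"
    proof -
      have "cos (\<phi> s) *\<^sub>R x s + sin (\<phi> s) *\<^sub>R y s
          = (cos (\<phi> s) * cos (\<phi> s)) *\<^sub>R \<beta> s + (sin (\<phi> s) * sin (\<phi> s)) *\<^sub>R \<beta> s"
        by (simp add: x_def y_def algebra_simps)
      then show ?thesis by (simp only: scaleR_add_left[symmetric] cs scaleR_one)
    qed
    have "P s * \<phi> s = \<gamma> s \<bullet> w s" using P_nonzero[OF s] by (simp add: \<phi>_def)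
    then have 2: "\<gamma> s = p s + (P s * \<phi> s) *\<^sub>R w s" by (simp add: p_def)
    have "\<alpha> s + t *\<^sub>R \<beta> s = \<gamma> s + (b s + t) *\<^sub>R \<beta> s"
      by (simp add: \<gamma>_def algebra_simps)
    also have "\<dots> = p s + (b s + t) *\<^sub>R \<beta> s + (P s * \<phi> s) *\<^sub>R w s"
      by (subst 2) simp
    also have "\<dots> = helicoid_point (P s) (x s) (y s) (p s) (\<phi> s) (b s + t)"
      by (simp add: helicoid_point_def w[OF s]) (simp flip: 1)
    also have "\<dots> = helicoid_point (P s0) (x s0) (y s0) (p s0) (\<phi> s) (b s + t)"
      by (simp only: const[OF s P'] const[OF s x] const[OF s y] const[OF s p])
    finally show "\<exists>\<sigma> \<tau>. \<alpha> s + t *\<^sub>R \<beta> s = helicoid_point (P s0) (x s0) (y s0) (p s0) \<sigma> \<tau>" by blast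
  qed
qed

end

section \<open>Helicoids\<close>

text \<open>An entire extension stands for real analyticity; an open set of reals accumulates at
  each of its points, so the identity theorem applies.\<close>

lemma holomorphic_zero_on_reals:
  fixes g :: "real \<Rightarrow> real" and G :: "complex \<Rightarrow> complex"
  assumes "G holomorphic_on UNIV" "\<And>t. G (of_real t) = of_real (g t)"
    and "open T" "s \<in> T" "\<And>t. t \<in> T \<Longrightarrow> g t = 0"
  shows "g t = 0"
proof -
  have "complex_of_real s islimpt (of_real ` T)"
  proof (rule islimptI)
    fix O' assume O: "complex_of_real s \<in> O'" "open O'"
    have "open (T \<inter> complex_of_real -` O')"
      using O(2) assms(3) by (intro open_Int open_vimage continuous_on_of_real continuous_on_id)
    then have "infinite (T \<inter> complex_of_real -` O')"
      using O(1) assms(4) finite_imp_not_open by blast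
    then obtain r where "r \<in> T \<inter> complex_of_real -` O'" "r \<noteq> s"
      by (metis finite.emptyI finite_insert insertI1 rev_finite_subset subsetI)
    then show "\<exists>y\<in>complex_of_real ` T. y \<in> O' \<and> y \<noteq> complex_of_real s" by auto
  qed
  then have "G (of_real t) = 0"
    by (rule analytic_continuation[OF assms(1) open_UNIV connected_UNIV subset_UNIV UNIV_I])
      (use assms in auto)
  then show ?thesis by (simp add: assms(2))
qed

locale helicoid_frame =
  fixes h :: real and x y p :: "real^3"
  assumes h_nonzero: "h \<noteq> 0" and orthonormal: "x \<bullet> x = 1" "y \<bullet> y = 1" "x \<bullet> y = 0"
begin

abbreviation "z \<equiv> cross3 x y"
abbreviation "\<Phi> \<equiv> helicoid_point h x y p"

text \<open>As \<open>h\<close> is nonzero, the height along the axis determines the angle. Hence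
  \<open>coords\<close> is defined and continuous on all of space, and on \<open>H\<close> it
  inverts the parametrization globally: the helicoid is an embedded plane.\<close>

definition "angle q = ((q - p) \<bullet> z) / h"
definition "H = range (\<lambda>u::real^2. \<Phi> (u$1) (u$2))"
definition coords :: "real^3 \<Rightarrow> real^2" where
  "coords q = vector [angle q, (q - p) \<bullet> (cos (angle q) *\<^sub>R x + sin (angle q) *\<^sub>R y)]"

lemma inner_frame: "x \<bullet> z = 0" "y \<bullet> z = 0" "z \<bullet> z = 1" "y \<bullet> x = 0"
  using orthonormal orthonormal_cross(3)[OF orthonormal] by (simp_all add: dot_cross_self inner_commute)

lemma Phi_inner: "(\<Phi> \<sigma> \<tau> - p) \<bullet> e = \<tau> * (cos \<sigma> * (x \<bullet> e) + sin \<sigma> * (y \<bullet> e)) + h * \<sigma> * (z \<bullet> e)"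
  by (simp add: helicoid_point_def inner_add_left algebra_simps)

lemma angle_Phi: "angle (\<Phi> \<sigma> \<tau>) = \<sigma>"
  using h_nonzero by (simp add: angle_def Phi_inner inner_frame)

lemma coords_Phi: "coords (\<Phi> \<sigma> \<tau>) = vector [\<sigma>, \<tau>]"
proof -
  have "(\<Phi> \<sigma> \<tau> - p) \<bullet> (cos \<sigma> *\<^sub>R x + sin \<sigma> *\<^sub>R y) = \<tau> * ((cos \<sigma>)\<^sup>2 + (sin \<sigma>)\<^sup>2)"
    by (simp only: Phi_inner) (simp add: inner_add_right inner_frame orthonormal inner_commute[of z] power2_eq_square)
  then show ?thesis by (simp add: coords_def angle_Phi)
qed

lemma Phi_coords: "q \<in> H \<Longrightarrow> \<Phi> (coords q $ 1) (coords q $ 2) = q"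
  by (auto simp: H_def coords_Phi)

text \<open>The implicit equation of the helicoid: at the angle read off from its height,
  \<open>q\<close> has no component orthogonal to both axis and ruling. It reduces membership to the
  zeros of one analytic function.\<close>

lemma mem_H: "q \<in> H \<longleftrightarrow> (q - p) \<bullet> (sin (angle q) *\<^sub>R x - cos (angle q) *\<^sub>R y) = 0"
proof
  assume "q \<in> H"
  then obtain u :: "real^2" where "q = \<Phi> (u$1) (u$2)" by (auto simp: H_def)
  then show "(q - p) \<bullet> (sin (angle q) *\<^sub>R x - cos (angle q) *\<^sub>R y) = 0"
    by (simp only: angle_Phi Phi_inner)
      (simp add: inner_diff_right inner_frame orthonormal inner_commute[of z])
next
  assume *: "(q - p) \<bullet> (sin (angle q) *\<^sub>R x - cos (angle q) *\<^sub>R y) = 0"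
  define \<sigma> where "\<sigma> = angle q"
  define A B where "A = (q - p) \<bullet> x" and "B = (q - p) \<bullet> y"
  have e: "sin \<sigma> * A = cos \<sigma> * B" using * by (simp add: inner_diff_right \<sigma>_def A_def B_def)
  have c: "(cos \<sigma>)\<^sup>2 + (sin \<sigma>)\<^sup>2 = 1" by simp
  define \<tau> where "\<tau> = cos \<sigma> * A + sin \<sigma> * B"
  have "\<tau> * cos \<sigma> = A" "\<tau> * sin \<sigma> = B" using e c unfolding \<tau>_def by algebra+
  moreover have "h * \<sigma> = (q - p) \<bullet> z" using h_nonzero by (simp add: \<sigma>_def angle_def)
  ultimately have "q - p = \<tau> *\<^sub>R (cos \<sigma> *\<^sub>R x + sin \<sigma> *\<^sub>R y) + (h * \<sigma>) *\<^sub>R z"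
    using orthonormal_cross(4)[OF orthonormal, of "q - p"]
    by (simp add: A_def[symmetric] B_def[symmetric] scaleR_add_right)
  then have "q = \<Phi> \<sigma> \<tau>" by (simp add: helicoid_point_def algebra_simps)
  then show "q \<in> H" by (auto simp: H_def intro!: image_eqI[of _ _ "vector [\<sigma>, \<tau>]"])
qed

lemma continuous_coords: "continuous_on A coords"
proof -
  have angle: "continuous_on A angle"
    unfolding angle_def[abs_def] using h_nonzero by (intro continuous_intros) auto
  have "continuous_on A (\<lambda>q. coords q $ 1)" "continuous_on A (\<lambda>q. coords q $ 2)"
    unfolding coords_def vector_2 by (intro continuous_intros angle)+
  then have "continuous_on A (\<lambda>q. coords q $ i)" for i
    using exhaust_2[of i] by auto
  then show ?thesis by (simp add: continuous_on_vec_lambda[of A "\<lambda>i q. coords q $ i", simplified])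
qed

lemma continuous_Phi: "continuous_on A (\<lambda>u::real^2. \<Phi> (u$1) (u$2))"
  unfolding helicoid_point_def by (intro continuous_intros)

text \<open>\<open>coords\<close> moves the image into the plane, where invariance of domain
  applies, and openness is pulled back along \<open>coords\<close>.\<close>

lemma openin_H_image:
  fixes X :: "real^2 \<Rightarrow> real^3"
  assumes "open U" "continuous_on U X" "inj_on X U" "X ` U \<subseteq> H"
  shows "openin (top_of_set H) (X ` U)"
proof -
  have inj: "inj_on coords H"
    by (metis Phi_coords inj_onI)
  have "open ((coords \<circ> X) ` U)"
    using assms inj
    by (intro invariance_of_domain continuous_on_compose continuous_coords comp_inj_on)
      (auto intro: inj_on_subset)
  moreover have "X ` U = H \<inter> coords -` ((coords \<circ> X) ` U)"
    using inj assms(4) by (auto dest: inj_onD)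
  moreover have "open (coords -` ((coords \<circ> X) ` U))"
    using calculation(1) by (rule open_vimage[OF _ continuous_coords])
  ultimately show ?thesis by (metis openin_open)
qed

end

text \<open>The parametrization of one helicoid inserted into the implicit equation of the other
  gives a function that is entire in each variable and vanishes on a rectangle.\<close>

lemma helicoid_subset:
  assumes A: "helicoid_frame h x y" and B: "helicoid_frame h' x' y'"
    and W: "openin (top_of_set (helicoid_frame.H h x y p)) W" "W \<noteq> {}"
      "W \<subseteq> helicoid_frame.H h' x' y' p'"
  shows "helicoid_frame.H h x y p \<subseteq> helicoid_frame.H h' x' y' p'"
proof -
  interpret A: helicoid_frame h x y p by fact
  interpret B: helicoid_frame h' x' y' p' by fact
  define L where "L e \<sigma> \<tau> = (p - p') \<bullet> e + (\<tau> * (cos \<sigma> * (x \<bullet> e) + sin \<sigma> * (y \<bullet> e)) + h * \<sigma> * (A.z \<bullet> e))" for e \<sigma> \<tau>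
  define LC where "LC e \<sigma> \<tau> = complex_of_real ((p - p') \<bullet> e) + (\<tau> * (cos \<sigma> * of_real (x \<bullet> e) + sin \<sigma> * of_real (y \<bullet> e))
      + of_real h * \<sigma> * of_real (A.z \<bullet> e))" for e \<sigma> \<tau>
  define g where "g \<sigma> \<tau> = sin (L B.z \<sigma> \<tau> / h') * L x' \<sigma> \<tau> - cos (L B.z \<sigma> \<tau> / h') * L y' \<sigma> \<tau>" for \<sigma> \<tau>
  define G where "G \<sigma> \<tau> = sin (LC B.z \<sigma> \<tau> / of_real h') * LC x' \<sigma> \<tau> - cos (LC B.z \<sigma> \<tau> / of_real h') * LC y' \<sigma> \<tau>" for \<sigma> \<tau>
  have L: "(A.\<Phi> \<sigma> \<tau> - p') \<bullet> e = L e \<sigma> \<tau>" for e \<sigma> \<tau>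
  proof -
    have "(A.\<Phi> \<sigma> \<tau> - p') \<bullet> e = (p - p') \<bullet> e + (A.\<Phi> \<sigma> \<tau> - p) \<bullet> e"
      by (simp add: inner_diff_left)
    then show ?thesis unfolding A.Phi_inner L_def .
  qed
  have mem: "A.\<Phi> \<sigma> \<tau> \<in> B.H \<longleftrightarrow> g \<sigma> \<tau> = 0" for \<sigma> \<tau>
    unfolding B.mem_H by (simp add: B.angle_def L inner_diff_right g_def)
  have GL: "LC e (of_real \<sigma>) (of_real \<tau>) = of_real (L e \<sigma> \<tau>)" for e \<sigma> \<tau>
    by (simp add: LC_def L_def sin_of_real cos_of_real)
  have G: "G (of_real \<sigma>) (of_real \<tau>) = of_real (g \<sigma> \<tau>)" for \<sigma> \<tau>
    by (simp add: G_def g_def GL sin_of_real[symmetric] cos_of_real[symmetric])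
  have hol: "(\<lambda>w. G w \<tau>) holomorphic_on UNIV" "(\<lambda>w. G \<sigma> w) holomorphic_on UNIV" for \<sigma> \<tau>
    using B.h_nonzero unfolding G_def LC_def by (auto intro!: holomorphic_intros)
  define O' where "O' = (\<lambda>u::real^2. A.\<Phi> (u$1) (u$2)) -` W"
  have "openin (top_of_set UNIV) (UNIV \<inter> (\<lambda>u::real^2. A.\<Phi> (u$1) (u$2)) -` W)"
    by (rule continuous_openin_preimage[OF A.continuous_Phi _ W(1)]) (auto simp: A.H_def)
  then have "open O'" by (simp add: O'_def)
  moreover have "W \<subseteq> A.H" using W(1) by (rule openin_imp_subset)
  then obtain u where u: "u \<in> O'" using W(2) by (auto simp: O'_def A.H_def)
  ultimately obtain e where e: "e > 0" "ball u e \<subseteq> O'" by (meson openE)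
  have zero: "g \<sigma> \<tau> = 0" if "\<bar>\<sigma> - u$1\<bar> < e/2" "\<bar>\<tau> - u$2\<bar> < e/2" for \<sigma> \<tau>
  proof -
    have "norm (u - vector [\<sigma>, \<tau>]) \<le> \<bar>u$1 - \<sigma>\<bar> + \<bar>u$2 - \<tau>\<bar>"
      using norm_le_l1_cart[of "u - vector [\<sigma>, \<tau>]"] by (simp add: sum_2)
    then have "vector [\<sigma>, \<tau>] \<in> ball u e" using that by (simp add: dist_norm abs_minus_commute)
    then have "A.\<Phi> \<sigma> \<tau> \<in> W" using e(2) by (auto simp: O'_def)
    then show ?thesis using mem W(3) by blast
  qed
  have op: "open {t. \<bar>t - c\<bar> < e/2}" "c \<in> {t. \<bar>t - c\<bar> < e/2}" for c
    using e(1) by (auto intro!: open_Collect_less continuous_intros)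
  \<comment> \<open>One variable at a time: first all \<tau> for \<sigma> near \<open>u$1\<close>,
    then all \<sigma>.\<close>
  have 1: "g \<sigma> \<tau> = 0" if "\<bar>\<sigma> - u$1\<bar> < e/2" for \<sigma> \<tau>
    by (rule holomorphic_zero_on_reals[OF hol(2)[of "of_real \<sigma>"] _ op, of "g \<sigma>" "u$2"]) (use that zero in \<open>auto simp: G\<close>)
  have "g \<sigma> \<tau> = 0" for \<sigma> \<tau>
    by (rule holomorphic_zero_on_reals[OF hol(1)[of "of_real \<tau>"] _ op, of "\<lambda>\<sigma>. g \<sigma> \<tau>" "u$1"]) (use 1 in \<open>auto simp: G\<close>)
  then show ?thesis using mem by (auto simp: A.H_def)
qed

text \<open>A rotation preserves cross products, so the image of the third axis is the cross product
  of the other two images; a reflection would flip its sign.\<close>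

lemma rotated_helicoid_point:
  assumes Q: "rotation_matrix Q"
  shows "Q *v vector [t * cos s, t * sin s, h * s] + b
    = helicoid_point h (Q *v axis 1 1) (Q *v axis 2 1) b s t"
proof -
  have "(vector [t * cos s, t * sin s, h * s] :: real^3)
      = t *\<^sub>R (cos s *\<^sub>R axis 1 1 + sin s *\<^sub>R axis 2 1) + (h * s) *\<^sub>R axis 3 (1::real) "
    by (simp add: vec_eq_iff forall_3 axis_def)
  moreover have "cross3 (Q *v axis 1 1) (Q *v axis 2 1) = Q *v axis 3 1"
    by (simp add: cross_rotation_matrix[OF Q] cross_basis)
  ultimately show ?thesis
    by (simp add: helicoid_point_def matrix_vector_right_distrib matrix_vector_mult_scaleR)
qed

lemma helicoid_iff:
  "helicoid S \<longleftrightarrow> (\<exists>h x y p. helicoid_frame h x y \<and> S = helicoid_frame.H h x y p)"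
proof
  assume "helicoid S"
  then obtain h Q b where h: "h \<noteq> 0" and Q: "rotation_matrix Q"
    and S: "S = (\<lambda>y. Q *v y + b) ` standard_helicoid h"
    unfolding helicoid_def by blast
  define x y where "x = Q *v axis 1 1" and "y = Q *v axis 2 1"
  have "orthogonal_transformation ((*v) Q)"
    using Q by (simp add: rotation_matrix_def orthogonal_transformation_matrix matrix_of_matrix_vector_mul)
  then have "(Q *v a) \<bullet> (Q *v b) = a \<bullet> b" for a b by (simp add: orthogonal_transformation_def)
  then interpret helicoid_frame h x y b
    by unfold_locales (simp_all add: h x_def y_def inner_axis_axis)
  have "S = H"
  proof (intro set_eqI iffI)
    fix q assume "q \<in> S"
    then obtain s t where "q = Q *v vector [t * cos s, t * sin s, h * s] + b"
      by (auto simp: S standard_helicoid_def)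
    then have "q = \<Phi> s t" by (simp add: rotated_helicoid_point[OF Q] x_def y_def)
    then show "q \<in> H" by (auto simp: H_def intro!: image_eqI[of _ _ "vector [s, t]"])
  next
    fix q assume "q \<in> H"
    then obtain u :: "real^2" where "q = \<Phi> (u$1) (u$2)" by (auto simp: H_def)
    then have "q = Q *v vector [u$2 * cos (u$1), u$2 * sin (u$1), h * u$1] + b"
      by (simp add: rotated_helicoid_point[OF Q] x_def y_def)
    then show "q \<in> S" unfolding S standard_helicoid_def by blast
  qed
  then show "\<exists>h x y p. helicoid_frame h x y \<and> S = helicoid_frame.H h x y p"
    using helicoid_frame_axioms by blast
next
  assume "\<exists>h x y p. helicoid_frame h x y \<and> S = helicoid_frame.H h x y p"
  then obtain h x y p where fr: "helicoid_frame h x y" and S: "S = helicoid_frame.H h x y p" by blast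
  interpret helicoid_frame h x y p by fact
  \<comment> \<open>The transpose of \<open>R\<close> has the frame as columns and so maps the
    standard axes to it; its determinant is 1 because \<open>z\<close> is the cross product of
    \<open>x\<close> and \<open>y\<close>.\<close>
  define R :: "real^3^3" where "R = vector [x, y, z]"
  define Q where "Q = transpose R"
  have "transpose Q ** Q = mat 1"
    using orthonormal inner_frame
    by (simp add: Q_def R_def vec_eq_iff forall_3 matrix_matrix_mult_def mat_def transpose_def sum_3
        inner_vec_def inner_real_def mult.commute)
  then have "orthogonal_matrix Q" by (simp add: orthogonal_matrix)
  moreover have "det Q = 1"
    by (simp add: Q_def R_def dot_cross_det[symmetric] orthonormal_cross(1)[OF orthonormal] orthonormal)
  ultimately have Q: "rotation_matrix Q" by (simp add: rotation_matrix_def)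
  have ax: "Q *v axis 1 1 = x" "Q *v axis 2 1 = y"
    by (simp_all add: Q_def R_def vec_eq_iff forall_3 matrix_vector_mult_def transpose_def sum_3 axis_def)
  have "S = (\<lambda>y. Q *v y + p) ` standard_helicoid h"
  proof (intro set_eqI iffI)
    fix q assume "q \<in> S"
    then obtain u :: "real^2" where "q = \<Phi> (u$1) (u$2)" by (auto simp: H_def S)
    then have "q = Q *v vector [u$2 * cos (u$1), u$2 * sin (u$1), h * u$1] + p"
      by (simp add: rotated_helicoid_point[OF Q] ax)
    then show "q \<in> (\<lambda>y. Q *v y + p) ` standard_helicoid h" unfolding standard_helicoid_def by blast
  next
    fix q assume "q \<in> (\<lambda>y. Q *v y + p) ` standard_helicoid h"
    then obtain s t where "q = Q *v vector [t * cos s, t * sin s, h * s] + p"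
      by (auto simp: standard_helicoid_def)
    then have "q = \<Phi> s t" by (simp add: rotated_helicoid_point[OF Q] ax)
    then show "q \<in> S" by (auto simp: H_def S intro!: image_eqI[of _ _ "vector [s, t]"])
  qed
  then show "helicoid S" unfolding helicoid_def using h_nonzero Q by blast
qed

text \<open>Changes the ambient space of openness from \<open>S\<close> to the helicoid: charts of
  \<open>S\<close> cover \<open>W\<close> by injective continuous images of planar open
  sets.\<close>

lemma openin_helicoid:
  assumes S: "regular_surface k S" and W: "openin (top_of_set S) W"
    and fr: "helicoid_frame h x y" and sub: "W \<subseteq> helicoid_frame.H h x y p"
  shows "openin (top_of_set (helicoid_frame.H h x y p)) W"
proof -
  interpret helicoid_frame h x y p by fact
  obtain O' where O: "open O'" "W = S \<inter> O'" using W by (auto simp: openin_open)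
  have "\<exists>V. openin (top_of_set H) V \<and> q \<in> V \<and> V \<subseteq> W" if q: "q \<in> W" for q
  proof -
    from S q O obtain U X where X: "local_parametrization k S U X" "q \<in> X ` U"
      unfolding regular_surface_def by blast
    then obtain Y where U: "open U" and hom: "homeomorphism U (X ` U) X Y" and "openin (top_of_set S) (X ` U)"
      unfolding local_parametrization_def by blast
    then have XS: "X ` U \<subseteq> S" using openin_imp_subset by blast
    have cont: "continuous_on U X" using hom by (rule homeomorphism_cont1)
    have inj: "inj_on X U" by (rule inj_on_inverseI[of U Y]) (rule homeomorphism_apply1[OF hom])
    define V where "V = U \<inter> X -` O'"
    have "open V" unfolding V_def using cont U O(1) by (rule continuous_open_preimage)
    moreover have "X ` V \<subseteq> W" "q \<in> X ` V" using XS X(2) q O(2) by (auto simp: V_def)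
    moreover have "continuous_on V X" "inj_on X V"
      using cont inj by (auto simp: V_def intro: continuous_on_subset inj_on_subset)
    ultimately show ?thesis
      using openin_H_image[of V X] sub by blast
  qed
  then show ?thesis by (subst openin_subopen) auto
qed

lemma helicoid_unique:
  assumes "regular_surface k S" "openin (top_of_set S) W" "W \<noteq> {}"
    and "helicoid H" "helicoid H'" "W \<subseteq> H" "W \<subseteq> H'"
  shows "H = H'"
proof -
  obtain h x y p where 1: "helicoid_frame h x y" "H = helicoid_frame.H h x y p"
    using assms(4) unfolding helicoid_iff by blast
  obtain h' x' y' p' where 2: "helicoid_frame h' x' y'" "H' = helicoid_frame.H h' x' y' p'"
    using assms(5) unfolding helicoid_iff by blast
  show ?thesis
    using helicoid_subset[OF 1(1) 2(1)] helicoid_subset[OF 2(1) 1(1)]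
      openin_helicoid[OF assms(1,2) 1(1)] openin_helicoid[OF assms(1,2) 2(1)] assms(3,6,7)
    unfolding 1(2) 2(2) by (meson subset_antisym)
qed

lemma helicoid_exists: "\<exists>H. helicoid H"
proof -
  have "helicoid_frame 1 (axis 1 1) (axis 2 1)"
    by unfold_locales (simp_all add: inner_axis_axis)
  then show ?thesis unfolding helicoid_iff by blast
qed

lemma open_part_of_helicoid_if_local:
  assumes S: "regular_surface k S" and conn: "connected S"
    and loc: "\<And>q. q \<in> S \<Longrightarrow> \<exists>W H. openin (top_of_set S) W \<and> q \<in> W \<and> helicoid H \<and> W \<subseteq> H"
  shows "open_part_of_helicoid S"
proof (cases "S = {}")
  case True
  then show ?thesis using helicoid_exists by (auto simp: open_part_of_helicoid_def)
next
  case False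
  then obtain q0 W0 H0 where q0: "openin (top_of_set S) W0" "q0 \<in> W0" "helicoid H0" "W0 \<subseteq> H0"
    using loc by blast
  \<comment> \<open>Points near which \<open>S\<close> lies in \<open>H0\<close>; \<open>B\<close>
    collects those near which it lies in some other helicoid. \<open>helicoid_unique\<close>
    separates the two sets.\<close>
  define A where "A = \<Union>{W. openin (top_of_set S) W \<and> W \<subseteq> H0}"
  define B where "B = \<Union>{W. openin (top_of_set S) W \<and> (\<exists>H. helicoid H \<and> H \<noteq> H0 \<and> W \<subseteq> H)}"
  have A: "openin (top_of_set S) A" and B: "openin (top_of_set S) B"
    unfolding A_def B_def by (auto intro: openin_Union)
  have SAB: "S \<subseteq> A \<union> B"
  proof
    fix q assume "q \<in> S"
    then obtain W H where "openin (top_of_set S) W" "q \<in> W" "helicoid H" "W \<subseteq> H"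
      using loc by blast
    then show "q \<in> A \<union> B" unfolding A_def B_def by (cases "H = H0") auto
  qed
  have disj: "A \<inter> B = {}"
  proof (rule ccontr)
    assume "A \<inter> B \<noteq> {}"
    then obtain q where "q \<in> A" "q \<in> B" by blast
    obtain V where V: "openin (top_of_set S) V" "V \<subseteq> H0" "q \<in> V"
      using \<open>q \<in> A\<close> unfolding A_def by blast
    obtain W H where W: "openin (top_of_set S) W" "helicoid H" "H \<noteq> H0" "W \<subseteq> H" "q \<in> W"
      using \<open>q \<in> B\<close> unfolding B_def by blast
    have "openin (top_of_set S) (V \<inter> W)" using V(1) W(1) by (rule openin_Int)
    moreover have "V \<inter> W \<noteq> {}" "V \<inter> W \<subseteq> H" "V \<inter> W \<subseteq> H0" using V W by auto
    ultimately have "H = H0" using helicoid_unique[OF S] W(2) q0(3) by meson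
    then show False using W(3) by simp
  qed
  have "A \<noteq> {}" unfolding A_def using q0 by auto
  then have "B = {}" using conn A B SAB disj unfolding connected_openin by meson
  with SAB have sub: "S \<subseteq> H0" unfolding A_def by auto
  obtain h x y p where 1: "helicoid_frame h x y" "H0 = helicoid_frame.H h x y p"
    using q0(3) unfolding helicoid_iff by blast
  have "openin (top_of_set H0) S"
    unfolding 1(2) by (rule openin_helicoid[OF S _ 1(1)]) (use sub 1(2) in auto)
  then show ?thesis using q0(3) unfolding open_part_of_helicoid_def by blast
qed

section \<open>Helicoids in arbitrary local coordinates\<close>

lemma pderiv_at_chain:
  assumes "\<sigma> differentiable (at u)" "(F has_vector_derivative F') (at (\<sigma> u))"
  shows "(\<lambda>w. F (\<sigma> w)) differentiable (at u)" "pderiv_at i (\<lambda>w. F (\<sigma> w)) u = pderiv_at i \<sigma> u *\<^sub>R F'"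
proof -
  have "((\<lambda>w. F (\<sigma> w)) has_derivative (\<lambda>d. frechet_derivative \<sigma> (at u) d *\<^sub>R F')) (at u)"
    using has_derivative_compose[of \<sigma> "frechet_derivative \<sigma> (at u)" u UNIV F "\<lambda>x. x *\<^sub>R F'"] assms
    by (simp add: frechet_derivative_works has_vector_derivative_def)
  then show "(\<lambda>w. F (\<sigma> w)) differentiable (at u)" "pderiv_at i (\<lambda>w. F (\<sigma> w)) u = pderiv_at i \<sigma> u *\<^sub>R F'"
    using has_derivative_pderiv by (auto simp: differentiable_def pderiv_at_def)
qed

lemma differentiable_inner:
  assumes "f differentiable (at u)" "g differentiable (at u)"
  shows "(\<lambda>w. f w \<bullet> g w) differentiable (at u)"
  using bounded_bilinear.FDERIV[OF bounded_bilinear_inner] assms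
  unfolding differentiable_def by blast

text \<open>Compares the normal of a chart with an explicit one: both are multiples of
  \<open>cross3 a b\<close>, hence equal up to the sign \<open>n \<bullet> m\<close>.\<close>

lemma parallel_unit_normals:
  assumes "cross3 a b \<noteq> 0" "n \<bullet> a = 0" "n \<bullet> b = 0" "m \<bullet> a = 0" "m \<bullet> b = 0"
    and "n \<bullet> n = 1" "m \<bullet> m = 1"
  shows "n = (n \<bullet> m) *\<^sub>R m" "(n \<bullet> m)\<^sup>2 = 1"
proof -
  have par: "(cross3 a b \<bullet> cross3 a b) *\<^sub>R q = (q \<bullet> cross3 a b) *\<^sub>R cross3 a b"
    if "q \<bullet> a = 0" "q \<bullet> b = 0" for q
  proof -
    have "cross3 (cross3 a b) (cross3 q (cross3 a b)) = 0"
      using that by (simp add: Lagrange[of q] inner_commute)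
    then show ?thesis by (simp add: Lagrange[of "cross3 a b"] inner_commute)
  qed
  define N where "N = cross3 a b"
  have N: "N \<bullet> N \<noteq> 0" using assms(1) by (simp add: N_def)
  have n: "n = ((n \<bullet> N) / (N \<bullet> N)) *\<^sub>R N" and m: "m = ((m \<bullet> N) / (N \<bullet> N)) *\<^sub>R N"
    using par[OF assms(2,3)] par[OF assms(4,5)] N unfolding N_def[symmetric]
    by (metis (no_types, opaque_lifting) divide_inverse inverse_scaleR_times mult.commute
        left_inverse scaleR_one scaleR_scaleR)+
  define c d where "c = (n \<bullet> N) / (N \<bullet> N)" and "d = (m \<bullet> N) / (N \<bullet> N)"
  have d: "d * d * (N \<bullet> N) = 1" "c * c * (N \<bullet> N) = 1"
    using assms(6,7) m n unfolding c_def[symmetric] d_def[symmetric] by (metis inner_scaleR_left inner_scaleR_right mult.assoc)+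
  have nm: "n \<bullet> m = c * d * (N \<bullet> N)"
    using m n unfolding c_def[symmetric] d_def[symmetric] by (metis inner_scaleR_left inner_scaleR_right mult.assoc)
  have "(n \<bullet> m) *\<^sub>R m = (c * (d * d * (N \<bullet> N))) *\<^sub>R N"
    using m unfolding d_def[symmetric] nm by (metis (no_types, opaque_lifting) mult.assoc mult.commute scaleR_scaleR)
  then show "n = (n \<bullet> m) *\<^sub>R m" using n d by (simp add: c_def[symmetric])
  show "(n \<bullet> m)\<^sup>2 = 1"
    unfolding nm using d by algebra
qed

locale helicoid_patch = helicoid_frame h x y p + nonparabolic_patch U X
  for h x y p U X +
  assumes image_subset: "X ` U \<subseteq> H"
begin

text \<open>The helicoid coordinates of \<open>X u\<close> as functions on the chart.
  \<open>dir (\<sigma> u)\<close> is the ruling, \<open>A u\<close> the unit tangent orthogonal to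
  it, \<open>m u\<close> a unit normal; \<open>ir\<close> is the inverse length of the derivative of
  the parametrization by the angle.\<close>

definition "\<sigma> u = angle (X u)"
definition "\<tau> u = (X u - p) \<bullet> (cos (\<sigma> u) *\<^sub>R x + sin (\<sigma> u) *\<^sub>R y)"
definition "dir s = cos s *\<^sub>R x + sin s *\<^sub>R y"
definition "dir' s = cos s *\<^sub>R y - sin s *\<^sub>R x"
definition "ir t = inverse (sqrt (t\<^sup>2 + h\<^sup>2))"
definition "A u = ir (\<tau> u) *\<^sub>R (\<tau> u *\<^sub>R dir' (\<sigma> u) + h *\<^sub>R z)"
definition "m u = (\<tau> u * ir (\<tau> u)) *\<^sub>R z - (h * ir (\<tau> u)) *\<^sub>R dir' (\<sigma> u)"

lemma dir: "(dir has_vector_derivative dir' s) (at s)" "(dir' has_vector_derivative - dir s) (at s)"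
  unfolding dir_def[abs_def] dir'_def[abs_def] has_vector_derivative_def
  by (auto intro!: derivative_eq_intros simp: algebra_simps)

lemma ir_pos: "ir t > 0"
  using h_nonzero by (simp add: ir_def sum_power2_gt_zero_iff)

lemma ir_sq: "(t\<^sup>2 + h\<^sup>2) * (ir t)\<^sup>2 = 1"
proof -
  have "t\<^sup>2 + h\<^sup>2 > 0" using h_nonzero by (simp add: sum_power2_gt_zero_iff)
  then have "t\<^sup>2 + h\<^sup>2 \<noteq> 0" "(ir t)\<^sup>2 = inverse (t\<^sup>2 + h\<^sup>2)"
    using h_nonzero by (simp_all add: ir_def power_inverse)
  then show ?thesis by (metis right_inverse)
qed

lemma ir_derivative: "(ir has_real_derivative - t * ir t ^ 3) (at t)"
proof -
  have pos: "t\<^sup>2 + h\<^sup>2 > 0" using h_nonzero by (simp add: sum_power2_gt_zero_iff)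
  have "((\<lambda>t. t\<^sup>2 + h\<^sup>2) has_real_derivative 2 * t) (at t)" by (auto intro!: derivative_eq_intros)
  from DERIV_chain2[of sqrt, OF DERIV_real_sqrt[OF pos] this]
  have A: "((\<lambda>t. sqrt (t\<^sup>2 + h\<^sup>2)) has_real_derivative t * ir t) (at t)" by (simp add: ir_def mult.commute)
  have nz: "sqrt (t\<^sup>2 + h\<^sup>2) \<noteq> 0" using h_nonzero by simp
  have ir: "ir = (\<lambda>t. inverse (sqrt (t\<^sup>2 + h\<^sup>2)))" by (simp add: ir_def fun_eq_iff)
  show ?thesis
    using DERIV_inverse'[OF A nz] by (simp add: ir power3_eq_cube mult_ac)
qed

lemma orthonormal_dir: "dir s \<bullet> dir s = 1" "dir' s \<bullet> dir' s = 1" "dir s \<bullet> dir' s = 0"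
  "dir s \<bullet> z = 0" "dir' s \<bullet> z = 0" "dir' s \<bullet> dir s = 0" "z \<bullet> dir' s = 0" "z \<bullet> dir s = 0"
proof -
  have zx: "z \<bullet> x = 0" "z \<bullet> y = 0" by (simp_all add: dot_cross_self)
  have cs: "cos s * cos s + sin s * sin s = 1" "sin s * sin s + cos s * cos s = 1"
    using sin_cos_squared_add3[of s] by linarith+
  show "dir s \<bullet> dir s = 1" "dir' s \<bullet> dir' s = 1" "dir s \<bullet> dir' s = 0"
    "dir s \<bullet> z = 0" "dir' s \<bullet> z = 0" "dir' s \<bullet> dir s = 0" "z \<bullet> dir' s = 0" "z \<bullet> dir s = 0"
    by (simp_all add: dir_def dir'_def inner_add_left inner_add_right inner_diff_left inner_diff_right
        orthonormal inner_frame zx cs)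
qed

lemma A_unit: "A u \<bullet> A u = 1" "dir (\<sigma> u) \<bullet> A u = 0" "A u \<bullet> dir (\<sigma> u) = 0"
  using ir_sq[of "\<tau> u"]
  by (simp_all add: A_def inner_add_left inner_add_right orthonormal_dir inner_frame power2_eq_square algebra_simps)

lemma m_unit: "m u \<bullet> m u = 1" "m u \<bullet> dir (\<sigma> u) = 0" "m u \<bullet> A u = 0"
  using ir_sq[of "\<tau> u"]
  by (simp_all add: m_def A_def inner_add_right inner_diff_left inner_diff_right orthonormal_dir inner_frame power2_eq_square algebra_simps)

context
  fixes u assumes u: "u \<in> U"
begin

lemma X_eq: "X u = p + (\<tau> u *\<^sub>R dir (\<sigma> u) + \<sigma> u *\<^sub>R (h *\<^sub>R z))"
proof -
  have "X u \<in> H" using image_subset u by auto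
  then have "\<Phi> (\<sigma> u) (\<tau> u) = X u"
    using Phi_coords by (simp add: coords_def \<sigma>_def \<tau>_def)
  then show ?thesis by (simp add: helicoid_point_def dir_def algebra_simps)
qed

lemma differentiable_sigma: "\<sigma> differentiable (at u)"
  unfolding \<sigma>_def[abs_def] angle_def divide_inverse
  by (intro differentiable_mult differentiable_inner differentiable_diff differentiable_const differentiable_X u)

lemma differentiable_dir: "(\<lambda>u. dir (\<sigma> u)) differentiable (at u)" "(\<lambda>u. dir' (\<sigma> u)) differentiable (at u)"
  using pderiv_at_chain(1)[OF differentiable_sigma] dir by blast+

lemma differentiable_tau: "\<tau> differentiable (at u)"
  unfolding \<tau>_def[abs_def] dir_def[symmetric]
  by (intro differentiable_inner differentiable_diff differentiable_const differentiable_X differentiable_dir(1) u)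

end

lemma pderiv_X:
  assumes u: "u \<in> U"
  shows "pderiv_at i X u = pderiv_at i \<tau> u *\<^sub>R dir (\<sigma> u) + (pderiv_at i \<sigma> u / ir (\<tau> u)) *\<^sub>R A u"
proof -
  have 1: "(\<lambda>w. \<tau> w *\<^sub>R dir (\<sigma> w)) differentiable (at u)"
    and 2: "(\<lambda>w. \<sigma> w *\<^sub>R (h *\<^sub>R z)) differentiable (at u)"
    by (intro derivative_intros differentiable_dir(1) differentiable_tau differentiable_sigma u)+
  have "pderiv_at i X u = pderiv_at i (\<lambda>w. p + (\<tau> w *\<^sub>R dir (\<sigma> w) + \<sigma> w *\<^sub>R (h *\<^sub>R z))) u"
    by (rule pderiv_at_cong[OF open_U u X_eq])
  also have "\<dots> = pderiv_at i (\<lambda>w. \<tau> w *\<^sub>R dir (\<sigma> w)) u + pderiv_at i (\<lambda>w. \<sigma> w *\<^sub>R (h *\<^sub>R z)) u"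
    by (subst pderiv_at_add, simp, intro derivative_intros 1 2, subst pderiv_at_add[OF 1 2])
      (simp add: pderiv_at_const)
  also have "pderiv_at i (\<lambda>w. \<tau> w *\<^sub>R dir (\<sigma> w)) u
      = \<tau> u *\<^sub>R (pderiv_at i \<sigma> u *\<^sub>R dir' (\<sigma> u)) + pderiv_at i \<tau> u *\<^sub>R dir (\<sigma> u)"
    by (simp add: pderiv_at_bilinear[OF bounded_bilinear_scaleR differentiable_tau[OF u] differentiable_dir(1)[OF u]]
        pderiv_at_chain(2)[OF differentiable_sigma[OF u] dir(1)])
  also have "pderiv_at i (\<lambda>w. \<sigma> w *\<^sub>R (h *\<^sub>R z)) u = pderiv_at i \<sigma> u *\<^sub>R (h *\<^sub>R z)"
    using pderiv_at_bilinear[OF bounded_bilinear_scaleR differentiable_sigma[OF u] differentiable_const, of i "h *\<^sub>R z"]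
    by (simp add: pderiv_at_const)
  finally show ?thesis
    using ir_pos[of "\<tau> u"] by (simp add: A_def algebra_simps)
qed

text \<open>The components of dX along \<open>dir\<close> and \<open>A\<close> reappear interchanged
  and scaled by \<open>h * (ir (\<tau> u))\<^sup>2\<close>. The differential of the Gauss map is
  thus a reflection times a scaling: conformal and of trace zero.\<close>

lemma pderiv_m:
  assumes u: "u \<in> U"
  shows "m differentiable (at u)"
    "pderiv_at i m u = (h * (ir (\<tau> u))\<^sup>2) *\<^sub>R
      ((pderiv_at i \<sigma> u / ir (\<tau> u)) *\<^sub>R dir (\<sigma> u) + pderiv_at i \<tau> u *\<^sub>R A u)"
proof -
  let ?t = "\<tau> u" and ?s = "\<sigma> u"
  note [simp] = has_real_derivative_iff_has_vector_derivative[symmetric]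
  have F1: "((\<lambda>t. (t * ir t) *\<^sub>R z) has_vector_derivative (h\<^sup>2 * ir ?t ^ 3) *\<^sub>R z) (at ?t)"
  proof -
    have "((\<lambda>t. t * ir t) has_real_derivative 1 * ir ?t + (- ?t * ir ?t ^ 3) * ?t) (at ?t)"
      by (rule DERIV_mult[OF DERIV_ident ir_derivative])
    moreover have "1 * ir ?t + (- ?t * ir ?t ^ 3) * ?t = h\<^sup>2 * ir ?t ^ 3"
    proof -
      have "ir ?t = ir ?t * ((?t\<^sup>2 + h\<^sup>2) * (ir ?t)\<^sup>2)" by (simp add: ir_sq)
      then show ?thesis by (simp add: algebra_simps power2_eq_square power3_eq_cube)
    qed
    ultimately show ?thesis
      using has_vector_derivative_scaleR[OF _ has_vector_derivative_const, of "\<lambda>t. t * ir t"] by fastforce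
  qed
  have F2: "((\<lambda>t. - h * ir t) has_vector_derivative h * ?t * ir ?t ^ 3) (at ?t)"
    using DERIV_cmult[OF ir_derivative, of "- h"] by (simp add: mult.assoc)
  have d1: "(\<lambda>w. (\<tau> w * ir (\<tau> w)) *\<^sub>R z) differentiable (at u)"
    and p1: "pderiv_at i (\<lambda>w. (\<tau> w * ir (\<tau> w)) *\<^sub>R z) u = pderiv_at i \<tau> u *\<^sub>R ((h\<^sup>2 * ir ?t ^ 3) *\<^sub>R z)"
    using pderiv_at_chain[OF differentiable_tau[OF u] F1] by auto
  have d2: "(\<lambda>w. - h * ir (\<tau> w)) differentiable (at u)"
    and p2: "pderiv_at i (\<lambda>w. - h * ir (\<tau> w)) u = pderiv_at i \<tau> u * (h * ?t * ir ?t ^ 3)"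
    using pderiv_at_chain[OF differentiable_tau[OF u] F2] by auto
  have d3: "(\<lambda>w. (- h * ir (\<tau> w)) *\<^sub>R dir' (\<sigma> w)) differentiable (at u)"
    by (intro differentiable_scaleR d2 differentiable_dir u)
  have m: "m = (\<lambda>w. (\<tau> w * ir (\<tau> w)) *\<^sub>R z + (- h * ir (\<tau> w)) *\<^sub>R dir' (\<sigma> w))"
    by (simp add: m_def fun_eq_iff)
  show "m differentiable (at u)" unfolding m by (intro differentiable_add d1 d3)
  have "pderiv_at i m u = pderiv_at i \<tau> u *\<^sub>R ((h\<^sup>2 * ir ?t ^ 3) *\<^sub>R z)
     + ((- h * ir ?t) *\<^sub>R (pderiv_at i \<sigma> u *\<^sub>R - dir ?s) + (pderiv_at i \<tau> u * (h * ?t * ir ?t ^ 3)) *\<^sub>R dir' ?s)"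
    unfolding m pderiv_at_add[OF d1 d3] p1
      pderiv_at_bilinear[OF bounded_bilinear_scaleR d2 differentiable_dir(2)[OF u]] p2
      pderiv_at_chain(2)[OF differentiable_sigma[OF u] dir(2)] ..
  then show "pderiv_at i m u = (h * (ir (\<tau> u))\<^sup>2) *\<^sub>R
      ((pderiv_at i \<sigma> u / ir (\<tau> u)) *\<^sub>R dir (\<sigma> u) + pderiv_at i \<tau> u *\<^sub>R A u)"
    using ir_pos[of ?t] by (simp add: A_def algebra_simps power2_eq_square power3_eq_cube)
qed

lemma normal_eq_m:
  assumes u: "u \<in> U"
  shows "n u = (n u \<bullet> m u) *\<^sub>R m u" "(n u \<bullet> m u)\<^sup>2 = 1"
  using parallel_unit_normals[OF normal_nonzero[OF u] normal_orthogonal normal_orthogonal _ _ normal_unit[OF u] m_unit(1)]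
    m_unit(2,3)[of u] by (simp_all add: pderiv_X[OF u] inner_add_right)

text \<open>The sign relating \<open>n\<close> and \<open>m\<close> has square 1, so differentiating
  the square shows that its derivative is zero.\<close>

lemma pderiv_normal:
  assumes u: "u \<in> U"
  shows "pderiv_at i n u = (n u \<bullet> m u) *\<^sub>R pderiv_at i m u"
proof -
  let ?e = "\<lambda>w. n w \<bullet> m w"
  have e: "?e differentiable (at u)"
    by (intro differentiable_inner differentiable_normal pderiv_m(1) u)
  have "pderiv_at i (\<lambda>w. ?e w * ?e w) u = pderiv_at i (\<lambda>w. 1) u"
    by (rule pderiv_at_cong[OF open_U u]) (simp add: normal_eq_m(2) power2_eq_square[symmetric])
  then have "?e u * pderiv_at i ?e u = 0"
    by (simp add: pderiv_at_bilinear[OF bounded_bilinear_mult e e] pderiv_at_const)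
  moreover have "?e u \<noteq> 0" using normal_eq_m(2)[OF u] by auto
  ultimately have "pderiv_at i ?e u = 0" by simp
  moreover have "pderiv_at i n u = pderiv_at i (\<lambda>w. ?e w *\<^sub>R m w) u"
    by (rule pderiv_at_cong[OF open_U u normal_eq_m(1)])
  ultimately show ?thesis
    by (simp add: pderiv_at_bilinear[OF bounded_bilinear_scaleR e pderiv_m(1)[OF u]])
qed

text \<open>On a helicoid the Gauss map is conformal, so \<open>V1\<close> and \<open>V2\<close> are the tangent
  vectors \<open>X2\<close> and \<open>X1\<close> turned by a right angle, whatever the conformal factor.\<close>

lemma third_form_conformal:
  assumes u: "u \<in> U"
  shows "third_form X u $ i $ j = (h * (ir (\<tau> u))\<^sup>2)\<^sup>2 * first_form X u $ i $ j"
proof -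
  have "(n u \<bullet> m u) * (n u \<bullet> m u) = 1" using normal_eq_m(2)[OF u] by (simp add: power2_eq_square)
  then have "third_form X u $ i $ j = pderiv_at i m u \<bullet> pderiv_at j m u"
    by (simp add: third_form_def pderiv_normal[OF u] mult.assoc[symmetric])
  then show ?thesis
    by (simp add: first_form_def pderiv_m[OF u] pderiv_X[OF u] inner_add_left inner_add_right A_unit
        orthonormal_dir algebra_simps power2_eq_square)
qed

text \<open>In dimension two sqrt(det e) scales like e itself, so the conformal factor
  cancels.\<close>

lemma V_eq:
  assumes u: "u \<in> U"
  shows "V1 u = cross3 (X2 u) (n u)" "V2 u = cross3 (n u) (X1 u)"
proof -
  define f where "f = (h * (ir (\<tau> u))\<^sup>2)\<^sup>2"
  define N where "N = cross3 (X1 u) (X2 u)"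
  have f: "f > 0" using ir_pos[of "\<tau> u"] h_nonzero by (simp add: f_def)
  have "det (third_form X u) = f\<^sup>2 * (N \<bullet> N)"
    unfolding det_2 third_form_conformal[OF u] f_def[symmetric] N_def dot_cross
    by (simp add: first_form_def inner_commute power2_eq_square algebra_simps)
  then have d: "sqrt (det (third_form X u)) = f * sqrt (N \<bullet> N)"
    using f by (simp add: real_sqrt_mult)
  define r where "r = sqrt (N \<bullet> N)"
  have scale: "inverse (f * r) *\<^sub>R ((f * a) *\<^sub>R v - (f * b) *\<^sub>R w) = inverse r *\<^sub>R (a *\<^sub>R v - b *\<^sub>R w)"
    for a b and v w :: "real^3"
    using f by (simp add: vec_eq_iff field_simps)
  have n: "n u = inverse r *\<^sub>R N" by (simp add: unit_normal_alt N_def r_def)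
  have c: "cross3 (X2 u) N = (X2 u \<bullet> X2 u) *\<^sub>R X1 u - (X1 u \<bullet> X2 u) *\<^sub>R X2 u"
    "cross3 N (X1 u) = (X1 u \<bullet> X1 u) *\<^sub>R X2 u - (X1 u \<bullet> X2 u) *\<^sub>R X1 u"
    using cross_skew[of N "X1 u"] by (simp_all add: N_def Lagrange inner_commute)
  have g: "first_form X u $ i $ j = pderiv_at i X u \<bullet> pderiv_at j X u" for i j
    by (simp add: first_form_def)
  show "V1 u = cross3 (X2 u) (n u)" "V2 u = cross3 (n u) (X1 u)"
    unfolding V1_def V2_def Let_def d r_def[symmetric] third_form_conformal[OF u] f_def[symmetric] scale g n
      cross_mult_left cross_mult_right c by simp_all
qed

text \<open>The product rule gives four terms. Those with second derivatives of \<open>X\<close>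
  cancel by their symmetry, those with derivatives of \<open>n\<close> because of the interchange in
  \<open>pderiv_m\<close>.\<close>

lemma beltrami_III_position_zero:
  assumes u: "u \<in> U"
  shows "beltrami_III_position X u = 0"
proof -
  have C: "C_nat_on 2 X U" using C3 by (rule C_nat_on_mono[rotated]) simp
  have V1: "pderiv_at 1 V1 u = cross3 (X2 u) (n1 u) + cross3 (pderiv_at 1 X2 u) (n u)"
    using pderiv_at_bilinear[OF bounded_bilinear_cross3, where f=X2 and g=n and u=u and i=1] differentiable_pderiv[OF u] differentiable_normal[OF u]
      pderiv_at_cong[OF open_U u V_eq(1), where i=1] by simp
  have V2: "pderiv_at 2 V2 u = cross3 (n u) (pderiv_at 2 X1 u) + cross3 (n2 u) (X1 u)"
    using pderiv_at_bilinear[OF bounded_bilinear_cross3, where f=n and g=X1 and u=u and i=2] differentiable_pderiv[OF u] differentiable_normal[OF u]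
      pderiv_at_cong[OF open_U u V_eq(2), where i=2] by simp
  have "pderiv_at 2 X1 u = pderiv_at 1 X2 u" by (rule pderiv_at_commute[OF open_U u C])
  then have "cross3 (n u) (pderiv_at 2 X1 u) = - cross3 (pderiv_at 1 X2 u) (n u)"
    using cross_skew[of "n u" "pderiv_at 2 X1 u"] by simp
  moreover have "cross3 (X2 u) (n1 u) + cross3 (n2 u) (X1 u) = 0"
    using cross_skew[of "A u" "dir (\<sigma> u)"] ir_pos[of "\<tau> u"]
    by (simp add: pderiv_normal[OF u] pderiv_m[OF u] pderiv_X[OF u] cross_add_left cross_add_right
        cross_mult_left cross_mult_right cross_refl algebra_simps)
  ultimately have "pderiv_at 1 V1 u + pderiv_at 2 V2 u = 0"
    unfolding V1 V2 by (simp add: algebra_simps)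
  then show ?thesis by (simp add: beltrami_III_position_eq[OF u])
qed

end

section \<open>Immersions into regular surfaces\<close>

lemma C_nat_on_compose_nth:
  fixes f :: "real \<Rightarrow> 'b::real_normed_vector" and D :: "(real^'n) set"
  assumes "open D" "D \<subseteq> {u. u $ i \<in> I}" "C_nat_on m f I"
  shows "C_nat_on m (\<lambda>u. f (u $ i)) D"
  using assms(3)
proof (induction m arbitrary: f)
  case 0
  then show ?case
    using assms(2) by (auto intro!: continuous_on_compose2[of I f] continuous_intros)
next
  case (Suc m)
  have "((\<lambda>u. f (u $ i)) has_derivative (\<lambda>v. frechet_derivative f (at (u $ i)) (v $ i))) (at u)"
    if "u \<in> D" for u
    using that assms(2) C_nat_on_has_derivative[OF Suc.prems, of "u $ i"]
    by (intro has_derivative_compose[OF bounded_linear_imp_has_derivative[OF bounded_linear_vec_nth]]) auto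
  then show ?case
    using Suc by (intro C_nat_on_SucI[OF assms(1)]) auto
qed

lemma C_on_ruled_map:
  assumes "open D" "D \<subseteq> {u. u $ 1 \<in> I}" "C_on k \<alpha> I" "C_on k \<beta> I"
  shows "C_on k (ruled_map \<alpha> \<beta>) D"
  unfolding C_on_def ruled_map_def[abs_def]
proof (intro allI impI)
  fix m assume m: "enat m \<le> k"
  note f = C_nat_on_compose_nth[OF assms(1,2) C_on_nat[OF assms(3) m]]
    and g = C_nat_on_compose_nth[OF assms(1,2) C_on_nat[OF assms(4) m]]
  show "C_nat_on m (\<lambda>u. \<alpha> (u $ 1) + u $ 2 *\<^sub>R \<beta> (u $ 1)) D"
    using assms(1) f C_nat_on_scaleR[OF assms(1) C_nat_on_linear[OF assms(1) bounded_linear_vec_nth] g]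
    by (rule C_nat_on_add)
qed

lemma C_on_subset: "C_on k f U \<Longrightarrow> V \<subseteq> U \<Longrightarrow> C_on k f V"
  by (auto simp: C_on_def intro: C_nat_on_subset)

text \<open>Continuous partial derivatives make the derivative continuous in operator norm: a
  tolerance e/3 for each of the two leaves 2e/3, strictly below e. Injectivity at \<open>u\<close>
  provides the left inverse \<open>g\<close>.\<close>

lemma immersion_locally_injective:
  assumes "open U" "C_nat_on 1 X U" "immersion_on U X" "u \<in> U"
  obtains r where "r > 0" "ball u r \<subseteq> U" "inj_on X (ball u r)"
proof -
  have C1: "C_nat_on (Suc 0) X U" using assms(2) by simp
  have der: "(X has_derivative frechet_derivative X (at w)) (at w)" if "w \<in> U" for w
    by (rule C_nat_on_has_derivative[OF C1 that])
  have "linear (frechet_derivative X (at u))" "inj (frechet_derivative X (at u))"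
    using der[OF assms(4)] assms(3,4) by (auto simp: immersion_on_def has_derivative_linear)
  then obtain g where g: "linear g" "g \<circ> frechet_derivative X (at u) = id"
    using linear_injective_left_inverse by blast
  have cont: "isCont (pderiv_at i X) u" for i
    using C_nat_on_continuous[OF C_nat_on_pderiv[OF C1]] assms(1,4)
    by (simp add: continuous_on_eq_continuous_at)
  have on: "\<exists>d>0. \<forall>w. dist u w < d \<longrightarrow> onorm (\<lambda>v. frechet_derivative X (at w) v - frechet_derivative X (at u) v) < e"
    if "e > 0" for e
  proof -
    have "\<exists>d>0. \<forall>w. dist w u < d \<longrightarrow> dist (pderiv_at i X w) (pderiv_at i X u) < e / 3" for i
      using cont[of i] \<open>e > 0\<close> unfolding continuous_at_eps_delta dist_norm
      by (metis divide_pos_pos zero_less_numeral)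
    then obtain d where d: "\<And>i. d i > 0"
      "\<And>i w. dist w u < d i \<Longrightarrow> dist (pderiv_at i X w) (pderiv_at i X u) < e / 3"
      by metis
    obtain d0 where d0: "d0 > 0" "ball u d0 \<subseteq> U" using assms(1,4) by (meson openE)
    define \<delta> where "\<delta> = min d0 (min (d 1) (d 2))"
    have "onorm (\<lambda>v. frechet_derivative X (at w) v - frechet_derivative X (at u) v) < e"
      if w: "dist u w < \<delta>" for w
    proof -
      have wU: "w \<in> U" using w d0 by (auto simp: \<delta>_def)
      have fd: "frechet_derivative X (at a) v = v$1 *\<^sub>R pderiv_at 1 X a + v$2 *\<^sub>R pderiv_at 2 X a"
        if "a \<in> U" for a v
        using fun_cong[OF frechet_derivative_at[OF has_derivative_pderivs[OF C_nat_on_differentiable[OF C1 that]]], of v]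
        by simp
      have small: "norm (pderiv_at i X w - pderiv_at i X u) \<le> e / 3" for i
        using d(2)[of w i] w exhaust_2[of i] by (auto simp: \<delta>_def dist_norm norm_minus_commute)
      have "norm (frechet_derivative X (at w) v - frechet_derivative X (at u) v) \<le> (2 * e / 3) * norm v" for v
      proof -
        have "frechet_derivative X (at w) v - frechet_derivative X (at u) v
            = v$1 *\<^sub>R (pderiv_at 1 X w - pderiv_at 1 X u) + v$2 *\<^sub>R (pderiv_at 2 X w - pderiv_at 2 X u)"
          by (simp add: fd[OF wU] fd[OF assms(4)] algebra_simps)
        also have "norm \<dots> \<le> \<bar>v$1\<bar> * (e/3) + \<bar>v$2\<bar> * (e/3)"
          by (rule order_trans[OF norm_triangle_ineq], unfold norm_scaleR)
            (intro add_mono mult_left_mono small abs_ge_zero)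
        also have "\<dots> \<le> norm v * (e/3) + norm v * (e/3)"
          using \<open>e > 0\<close> by (intro add_mono mult_right_mono component_le_norm_cart) auto
        finally show ?thesis by (simp add: algebra_simps)
      qed
      then have "onorm (\<lambda>v. frechet_derivative X (at w) v - frechet_derivative X (at u) v) \<le> 2 * e / 3"
        by (rule onorm_le)
      then show ?thesis using \<open>e > 0\<close> by linarith
    qed
    moreover have "\<delta> > 0" using d0 d(1) by (simp add: \<delta>_def)
    ultimately show ?thesis by blast
  qed
  obtain r where "r > 0" "ball u r \<subseteq> U" "inj_on X (ball u r)"
    by (rule has_derivative_locally_injective[OF assms(4,1) linear_linear[THEN iffD2, OF g(1)] g(2) der on])
  then show thesis by (rule that)
qed

text \<open>Locally \<open>f\<close> followed by the inverse of a chart is an injective continuous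
  map between planar sets, so invariance of domain applies.\<close>

lemma regular_surface_open_map:
  fixes f :: "real^2 \<Rightarrow> real^3"
  assumes S: "regular_surface k S" and V: "open V" and cont: "continuous_on V f"
    and inj: "inj_on f V" and sub: "f ` V \<subseteq> S"
  shows "openin (top_of_set S) (f ` V)"
proof -
  have "\<exists>W. openin (top_of_set S) W \<and> q \<in> W \<and> W \<subseteq> f ` V" if q: "q \<in> f ` V" for q
  proof -
    obtain U X where X: "local_parametrization k S U X" "q \<in> X ` U"
      using S q sub unfolding regular_surface_def by blast
    then obtain Y where U: "open U" and hom: "homeomorphism U (X ` U) X Y"
      and XU: "openin (top_of_set S) (X ` U)"
      unfolding local_parametrization_def by blast
    obtain O' where O: "open O'" "X ` U = S \<inter> O'" using XU by (auto simp: openin_open)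
    define V' where "V' = V \<inter> f -` O'"
    have V': "open V'" unfolding V'_def using cont V O(1) by (rule continuous_open_preimage)
    have fV': "f ` V' \<subseteq> X ` U" using sub O(2) by (auto simp: V'_def)
    have "continuous_on V' (Y \<circ> f)"
      using fV' by (intro continuous_on_compose continuous_on_subset[OF cont]
          continuous_on_subset[OF homeomorphism_cont2[OF hom]]) (auto simp: V'_def)
    moreover have injY: "inj_on Y (X ` U)"
      by (rule inj_on_inverseI[of _ X]) (rule homeomorphism_apply2[OF hom])
    then have "inj_on (Y \<circ> f) V'"
      using inj fV' by (intro comp_inj_on) (auto simp: V'_def intro: inj_on_subset)
    ultimately have "open ((Y \<circ> f) ` V')" using V' by (intro invariance_of_domain)
    moreover have YU: "(Y \<circ> f) ` V' \<subseteq> U"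
      using fV' homeomorphism_image2[OF hom] by auto
    ultimately have "openin (top_of_set U) ((Y \<circ> f) ` V')"
      using U by (simp add: openin_open_eq)
    then have "openin (top_of_set (X ` U)) (X ` ((Y \<circ> f) ` V'))"
      by (rule homeomorphism_imp_open_map[OF hom])
    moreover have "X ` ((Y \<circ> f) ` V') = f ` V'"
      unfolding image_image using fV' by (intro image_cong refl) (auto simp: homeomorphism_apply2[OF hom])
    ultimately have "openin (top_of_set S) (f ` V')" using XU openin_trans by metis
    moreover have "q \<in> f ` V'" using q X(2) O(2) by (auto simp: V'_def)
    moreover have "f ` V' \<subseteq> f ` V" by (auto simp: V'_def)
    ultimately show ?thesis by blast
  qed
  then show ?thesis by (subst openin_subopen) auto
qed

text \<open>Makes injective pieces of the ruled map accessible to the hypotheses on \<Lambda> and on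
  curvature, which concern only local parametrizations.\<close>

lemma local_parametrizationI:
  assumes S: "regular_surface k S" and V: "open V" and C: "C_on k X V" and im: "immersion_on V X"
    and inj: "inj_on X V" and sub: "X ` V \<subseteq> S"
  shows "local_parametrization k S V X"
proof -
  have cont: "continuous_on V X"
    using C by (simp add: C_on_def) (metis C_nat_on.simps(1) i0_lb zero_enat_def)
  have op: "openin (top_of_set S) (X ` W)" if "open W" "W \<subseteq> V" for W
    using that sub by (intro regular_surface_open_map[OF S] continuous_on_subset[OF cont] inj_on_subset[OF inj]) auto
  have "openin (top_of_set (X ` V)) (X ` W)" if "openin (top_of_set V) W" for W
  proof -
    have "open W" "W \<subseteq> V" using that V by (auto simp: openin_open_eq)
    then have "openin (top_of_set S) (X ` W)" "X ` W \<subseteq> X ` V" using op by auto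
    then show ?thesis using sub by (rule openin_subset_trans)
  qed
  then obtain Y where "homeomorphism V (X ` V) X Y"
    by (rule homeomorphism_injective_open_map[OF cont refl inj])
  then show ?thesis
    unfolding local_parametrization_def using V C im op[OF V order_refl] by blast
qed

lemma nonparabolic_patchI:
  assumes "3 \<le> k" "no_parabolic_points k S" "local_parametrization k S U X"
  shows "nonparabolic_patch U X"
proof
  show "open U" "immersion_on U X" using assms(3) by (auto simp: local_parametrization_def)
  show "C_nat_on 3 X U"
    using assms(1,3) by (intro C_on_nat[of k]) (auto simp: local_parametrization_def numeral_eq_enat)
  show "gauss_curvature X u \<noteq> 0" if "u \<in> U" for u
    using assms(2,3) that by (auto simp: no_parabolic_points_def)
qed

lemma C_nat_on_vector_derivative:
  fixes f :: "real \<Rightarrow> 'b::real_normed_vector"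
  assumes "C_nat_on (Suc m) f I" "s \<in> I"
  shows "(f has_vector_derivative frechet_derivative f (at s) 1) (at s)"
proof -
  have d: "(f has_derivative frechet_derivative f (at s)) (at s)"
    by (rule C_nat_on_has_derivative[OF assms])
  have "frechet_derivative f (at s) x = x *\<^sub>R frechet_derivative f (at s) 1" for x
    using linear_scale[OF has_derivative_linear[OF d], of x 1] by simp
  then show ?thesis using d unfolding has_vector_derivative_def by (metis (no_types, lifting) ext)
qed

theorem proposition1:
  fixes S :: "(real^3) set" and k :: enat
  assumes "3 \<le> k"
    and "regular_surface k S"
    and "connected S"
    and "no_parabolic_points k S"
    and "open_part_of_ruled_surface k S"
  shows "(\<exists>\<Lambda> :: real^3^3. \<forall>U X. local_parametrization k S U X \<longrightarrow>
            (\<forall>u\<in>U. beltrami_III_position X u = \<Lambda> *v X u))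
         \<longleftrightarrow> open_part_of_helicoid S"
proof
  assume "open_part_of_helicoid S"
  then obtain h x y p where fr: "helicoid_frame h x y" and S: "S \<subseteq> helicoid_frame.H h x y p"
    unfolding open_part_of_helicoid_def helicoid_iff using openin_imp_subset by blast
  have "beltrami_III_position X u = 0 *v X u" if X: "local_parametrization k S U X" and u: "u \<in> U" for U X u
  proof -
    have "openin (top_of_set S) (X ` U)" using X by (auto simp: local_parametrization_def)
    then have "X ` U \<subseteq> S" by (rule openin_imp_subset)
    then have "helicoid_patch h x y p U X"
      using fr nonparabolic_patchI[OF assms(1,4) X] S
      by (auto simp: helicoid_patch_def helicoid_patch_axioms_def)
    then show ?thesis using u by (simp add: helicoid_patch.beltrami_III_position_zero)
  qed
  then show "\<exists>\<Lambda> :: real^3^3. \<forall>U X. local_parametrization k S U X \<longrightarrow>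
      (\<forall>u\<in>U. beltrami_III_position X u = \<Lambda> *v X u)" by blast
next
  assume "\<exists>\<Lambda> :: real^3^3. \<forall>U X. local_parametrization k S U X \<longrightarrow>
      (\<forall>u\<in>U. beltrami_III_position X u = \<Lambda> *v X u)"
  then obtain \<Lambda> :: "real^3^3" where \<Lambda>: "\<And>U X u. local_parametrization k S U X \<Longrightarrow> u \<in> U \<Longrightarrow>
      beltrami_III_position X u = \<Lambda> *v X u" by blast
  obtain I \<alpha> \<beta> D where I: "open I" and C: "C_on k \<alpha> I" "C_on k \<beta> I"
    and unit: "\<And>s. s \<in> I \<Longrightarrow> norm (\<beta> s) = 1"
    and D: "open D" "D \<subseteq> {u. u $ 1 \<in> I}" "immersion_on D (ruled_map \<alpha> \<beta>)"
    and S: "S = ruled_map \<alpha> \<beta> ` D"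
    using assms(5) unfolding open_part_of_ruled_surface_def by blast
  let ?X = "ruled_map \<alpha> \<beta>"
  have CD: "C_on k ?X D" by (rule C_on_ruled_map[OF D(1,2) C])
  define d1 :: "(real \<Rightarrow> real^3) \<Rightarrow> real \<Rightarrow> real^3" where "d1 f s = frechet_derivative f (at s) 1" for f s
  have three: "enat (Suc (Suc (Suc 0))) \<le> k" using assms(1) by (simp add: numeral_eq_enat eval_nat_numeral)
  have der: "(f has_vector_derivative d1 f s) (at s)" "(d1 f has_vector_derivative d1 (d1 f) s) (at s)"
    if "C_on k f I" "s \<in> I" for f s
  proof -
    have c: "C_nat_on (Suc (Suc (Suc 0))) f I" by (rule C_on_nat[OF that(1) three])
    then have "C_nat_on (Suc (Suc 0)) (d1 f) I" by (simp add: d1_def[abs_def])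
    then show "(f has_vector_derivative d1 f s) (at s)" "(d1 f has_vector_derivative d1 (d1 f) s) (at s)"
      using C_nat_on_vector_derivative[OF c that(2)] C_nat_on_vector_derivative[of 1 "d1 f" I s] that(2)
      by (simp_all add: d1_def del: C_nat_on.simps)
  qed
  show "open_part_of_helicoid S"
  proof (rule open_part_of_helicoid_if_local[OF assms(2,3)])
    fix q assume "q \<in> S"
    then obtain u0 where u0: "u0 \<in> D" "q = ?X u0" by (auto simp: S)
    have C1: "C_nat_on 1 ?X D"
      using CD assms(1) by (intro C_nat_on_mono[OF _ C_on_nat[OF CD three]]) simp
    obtain r where r: "r > 0" "ball u0 r \<subseteq> D" "inj_on ?X (ball u0 r)"
      using immersion_locally_injective[OF D(1) C1 D(3) u0(1)] .
    let ?V = "ball u0 r"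
    have par: "local_parametrization k S W ?X" if "open W" "W \<subseteq> ?V" for W
      using that r D(3) S
      by (intro local_parametrizationI[OF assms(2)] C_on_subset[OF CD] inj_on_subset[OF r(3)])
        (auto simp: immersion_on_def)
    have patch: "nonparabolic_patch ?V ?X"
      by (rule nonparabolic_patchI[OF assms(1,4) par]) auto
    \<comment> \<open>Half the radius on each side keeps the rectangle \<open>J\<close> times
      \<open>T\<close> inside the ball, by the l1 bound on the norm.\<close>
    define J where "J = {s. \<bar>s - u0$1\<bar> < r/2}"
    define T where "T = {t. \<bar>t - u0$2\<bar> < r/2}"
    have J: "J = ball (u0$1) (r/2)" and T: "T = ball (u0$2) (r/2)"
      by (auto simp: J_def T_def dist_real_def abs_minus_commute)
    have inV: "vector [s, t] \<in> ?V" if "s \<in> J" "t \<in> T" for s t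
    proof -
      have "norm (u0 - vector [s, t]) \<le> \<bar>u0$1 - s\<bar> + \<bar>u0$2 - t\<bar>"
        using norm_le_l1_cart[of "u0 - vector [s, t]"] by (simp add: sum_2)
      then show ?thesis using that by (simp add: J_def T_def dist_norm abs_minus_commute)
    qed
    have JI: "s \<in> I" if "s \<in> J" for s
    proof -
      have "vector [s, u0$2] \<in> D" using inV[OF that, of "u0$2"] r by (auto simp: T_def)
      then show ?thesis using D(2) by auto
    qed
    have VI: "?V \<subseteq> {u. u $ 1 \<in> I}" using r(2) D(2) by blast
    note E = ruled_beltrami_equation[OF patch I VI unit der(1)[OF C(1)] der(1)[OF C(2)]
        der(2)[OF C(1)] der(2)[OF C(2)] \<Lambda>[OF par[OF open_ball order_refl]]]
    have "skew_rulings J T \<alpha> \<beta> (d1 \<alpha>) (d1 \<beta>) (d1 (d1 \<alpha>)) (d1 (d1 \<beta>)) \<Lambda>"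
    proof
      show "open J" "open T" "T \<noteq> {}" using r(1) by (auto simp: J T)
      show "\<beta> s \<bullet> \<beta> s = 1" if "s \<in> J" for s using unit[OF JI[OF that]] by (simp add: dot_square_norm)
      show "d1 \<beta> s \<bullet> cross3 (d1 \<alpha> s) (\<beta> s) \<noteq> 0" if s: "s \<in> J" for s
        using E(1)[OF _ _ _ _ _ _ inV[OF s, of "u0$2"] refl refl] r(1) by (simp add: T_def)
      show "let N = cross3 (d1 \<alpha> s + t *\<^sub>R d1 \<beta> s) (\<beta> s); \<delta> = d1 \<beta> s \<bullet> cross3 (d1 \<alpha> s) (\<beta> s) in
          ((\<Lambda> *v (\<alpha> s + t *\<^sub>R \<beta> s)) \<bullet> N) * \<delta>\<^sup>2
          = (N \<bullet> N) * ((d1 (d1 \<alpha>) s + t *\<^sub>R d1 (d1 \<beta>) s) \<bullet> N - 2 * \<delta> * (d1 \<alpha> s \<bullet> \<beta> s))"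
        if st: "s \<in> J" "t \<in> T" for s t
        using E(2)[OF _ _ _ _ _ _ inV[OF st] refl refl] by (simp add: Let_def)
    qed (use JI der C in auto)
    then interpret skew_rulings J T \<alpha> \<beta> "d1 \<alpha>" "d1 \<beta>" "d1 (d1 \<alpha>)" "d1 (d1 \<beta>)" \<Lambda> .
    have "convex J" "J \<noteq> {}" using r(1) by (auto simp: J)
    then obtain h x y p where fr: "h \<noteq> 0" "x \<bullet> x = 1" "y \<bullet> y = 1" "x \<bullet> y = 0"
      and cont: "\<And>s t. s \<in> J \<Longrightarrow> \<exists>\<sigma> \<tau>. \<alpha> s + t *\<^sub>R \<beta> s = helicoid_point h x y p \<sigma> \<tau>"
      using contained_in_helicoid by metis
    interpret F: helicoid_frame h x y p using fr by unfold_locales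
    \<comment> \<open>Halving the radius puts the first coordinate into \<open>J\<close>; the second
      is unrestricted in \<open>cont\<close>.\<close>
    let ?W = "?X ` ball u0 (r/2)"
    have "?W \<subseteq> F.H"
    proof clarify
      fix u assume "u \<in> ball u0 (r/2)"
      then have "u $ 1 \<in> J"
        using component_le_norm_cart[of "u - u0" 1] by (simp add: J_def dist_norm norm_minus_commute)
      then obtain \<sigma> \<tau> where "?X u = helicoid_point h x y p \<sigma> \<tau>"
        using cont[of "u $ 1" "u $ 2"] by (auto simp: ruled_map_def)
      then show "?X u \<in> F.H" by (auto simp: F.H_def intro!: image_eqI[of _ _ "vector [\<sigma>, \<tau>]"])
    qed
    moreover have "openin (top_of_set S) ?W"
      using par[of "ball u0 (r/2)"] r(1) by (simp add: local_parametrization_def subset_ball)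
    moreover have "helicoid F.H" unfolding helicoid_iff using F.helicoid_frame_axioms by blast
    moreover have "q \<in> ?W" using r(1) u0(2) by simp
    ultimately show "\<exists>W H. openin (top_of_set S) W \<and> q \<in> W \<and> helicoid H \<and> W \<subseteq> H" by blast
  qed
qed

end
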